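(* Let $X$ be a path-connected space, $x_0\in X$, and $H\leq\pi_1(X,x_0)$ a subgroup. If $X$ is homotopically path Hausdorff relative to $H$, then $H$ is $(S,d_\infty)$-closed. The converse holds if the path space $P(X)$ is first countable (for instance, if $X$ is metrizable): in that case, if $H$ is $(S,d_\infty)$-closed, then $X$ is homotopically path Hausdorff relative to $H$.
   Context: A map is a continuous function; $f_{\#}$ denotes the homomorphism induced on fundamental groups. For paths, $\alpha\cdot\beta$ is concatenation, $\alpha^{-}(t)=\alpha(1-t)$, and $\prod_{j=1}^m\alpha_j$ is the concatenation which is $\alpha_j$ on $[\frac{j-1}{m},\frac jm]$. $P(X)$ is the space of paths $[0,1]\to X$ with the compact-open topology, and $P(X,x_0)$ the subspace of paths starting at $x_0$. $X$ is homotopically path Hausdorff relative to $H$ if for every pair $\alpha,\beta\in P(X,x_0)$ with $\alpha(1)=\beta(1)$ and $[\alpha\cdot\beta^{-}]\notin H$, there are an integer $n\geq1$ and open sets $U_1,\dots,U_{2^{n-1}}$ with $\alpha([\frac{j-1}{2^{n-1}},\frac{j}{2^{n-1}}])\subseteq U_j$ for all $j$, such that if $\gamma:[0,1]\to X$ is another path satisfying $\gamma([\frac{j-1}{2^{n-1}},\frac{j}{2^{n-1}}])\subseteq U_j$ for $1\leq j\leq2^{n-1}$ and $\gamma(\frac{j}{2^{n-1}})=\alpha(\frac{j}{2^{n-1}})$ for $0\leq j\leq2^{n-1}$, then $[\gamma\cdot\beta^{-}]\notin H$. Closed subgroups: for a based space $(\mathbb{T},t_0)$, a subgroup $T\leq\pi_1(\mathbb{T},t_0)$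 and $g\in\pi_1(\mathbb{T},t_0)$, a subgroup $H\leq\pi_1(X,x_0)$ is $(T,g)$-closed if for every map $f:(\mathbb{T},t_0)\to(X,x_0)$ with $f_{\#}(T)\leq H$ we have $f_{\#}(g)\in H$. The test space $\mathbb{D}$: for integers $n\geq1$, $1\leq j\leq 2^{n-1}$ let $\mathbb{D}(n,j)=\{(x,y)\in\mathbb{R}^2\mid (x-\frac{2j-1}{2^n})^2+y^2=(\frac1{2^n})^2,\ y\geq0\}$, let $B=[0,1]\times\{0\}$, and let $\mathbb{D}=B\cup\bigcup_{n,j}\mathbb{D}(n,j)\subseteq\mathbb{R}^2$ with the subspace topology and basepoint $d_0=(0,0)$. Let $\ell_{n,j}:[0,1]\to\mathbb{D}(n,j)$, $\ell_{n,j}(t)=\left(\frac{t+j-1}{2^{n-1}},\frac{1}{2^{n-1}}\sqrt{t-t^2}\right)$, let $\lambda_n=\prod_{j=1}^{2^{n-1}}\ell_{n,j}$ (a path from $(0,0)$ to $(1,0)$) and $\lambda_\infty(t)=(t,0)$. Put $s_n=[\lambda_n\cdot\lambda_{n+1}^{-}]$, let $S\leq\pi_1(\mathbb{D},d_0)$ be the subgroup generated by $\{s_n\mid n\in\mathbb{N}\}$, and let $d_\infty=[\lambda_1\cdot\lambda_\infty^{-}]$. *)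

theory Defs
  imports "HOL-Analysis.Analysis" "HOL-Algebra.Generated_Groups"
begin

text \<open>
  A topological space is a set \<open>X :: 'a::topological_space set\<close> with the subspace topology.
  As in the library, a path in \<open>X\<close> is a total function on the reals of which only the
  restriction to \<open>{0..1}\<close> matters.
\<close>

definition paths_from :: "'a::topological_space set \<Rightarrow> 'a \<Rightarrow> (real \<Rightarrow> 'a) set" where
  "paths_from X x0 = {p. path p \<and> path_image p \<subseteq> X \<and> pathstart p = x0}"

definition loops_at :: "'a::topological_space set \<Rightarrow> 'a \<Rightarrow> (real \<Rightarrow> 'a) set" where
  "loops_at X x0 = {p \<in> paths_from X x0. pathfinish p = x0}"

definition path_class :: "'a::topological_space set \<Rightarrow> (real \<Rightarrow> 'a) \<Rightarrow> (real \<Rightarrow> 'a) set" where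
  "path_class X p = {q. homotopic_paths X p q}"

definition fundamental_group ::
    "'a::topological_space set \<Rightarrow> 'a \<Rightarrow> (real \<Rightarrow> 'a) set monoid" where
  "fundamental_group X x0 =
     \<lparr> carrier = path_class X ` loops_at X x0,
       mult = (\<lambda>A B. \<Union>p\<in>A. \<Union>q\<in>B. path_class X (p +++ q)),
       one = path_class X (\<lambda>_. x0) \<rparr>"

text \<open>The homomorphism induced by a map \<open>f\<close> into \<open>Y\<close>, that is, \<open>[p] \<mapsto> [f \<circ> p]\<close>.\<close>

definition induced_hom ::
    "'b::topological_space set \<Rightarrow> ('a::topological_space \<Rightarrow> 'b) \<Rightarrow>
     (real \<Rightarrow> 'a) set \<Rightarrow> (real \<Rightarrow> 'b) set" where
  "induced_hom Y f A = (\<Union>p\<in>A. path_class Y (f \<circ> p))"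

text \<open>
  The space of all paths in \<open>X\<close> with the compact-open topology. Paths are made extensional here,
  so that each path is a single point of the space.
\<close>

definition path_space :: "'a::topological_space set \<Rightarrow> (real \<Rightarrow> 'a) topology" where
  "path_space X =
     (let P = {p \<in> extensional {0..1}. path p \<and> path_image p \<subseteq> X}
      in topology_generated_by
           {{p \<in> P. p ` K \<subseteq> U} | K U.
              compact K \<and> K \<subseteq> {0..1} \<and> openin (top_of_set X) U})"

text \<open>
  The concatenation of \<open>a 1, \<dots>, a m\<close>, equal to \<open>a j\<close> (rescaled) on \<open>{(j - 1)/m .. j/m}\<close>;
  at a common endpoint the smaller index is used.
\<close>

definition concat_paths :: "nat \<Rightarrow> (nat \<Rightarrow> real \<Rightarrow> 'a) \<Rightarrow> real \<Rightarrow> 'a" where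
  "concat_paths m a t =
     (let j = max 1 (nat \<lceil>real m * t\<rceil>) in a j (real m * t - (real j - 1)))"

definition homotopically_path_Hausdorff_rel ::
    "'a::topological_space set \<Rightarrow> 'a \<Rightarrow> (real \<Rightarrow> 'a) set set \<Rightarrow> bool" where
  "homotopically_path_Hausdorff_rel X x0 H \<longleftrightarrow>
     (\<forall>\<alpha> \<in> paths_from X x0. \<forall>\<beta> \<in> paths_from X x0.
        pathfinish \<alpha> = pathfinish \<beta> \<and> path_class X (\<alpha> +++ reversepath \<beta>) \<notin> H \<longrightarrow>
        (\<exists>n\<ge>1. \<exists>U :: nat \<Rightarrow> 'a set.
           (\<forall>j\<in>{1..2^(n-1)}.
              openin (top_of_set X) (U j) \<and>
              \<alpha> ` {(real j - 1) / 2^(n-1) .. real j / 2^(n-1)} \<subseteq> U j) \<and>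
           (\<forall>\<gamma>. path \<gamma> \<and> path_image \<gamma> \<subseteq> X \<and>
              (\<forall>j\<in>{1..2^(n-1)}. \<gamma> ` {(real j - 1) / 2^(n-1) .. real j / 2^(n-1)} \<subseteq> U j) \<and>
              (\<forall>j\<in>{0..2^(n-1)}. \<gamma> (real j / 2^(n-1)) = \<alpha> (real j / 2^(n-1))) \<longrightarrow>
              path_class X (\<gamma> +++ reversepath \<beta>) \<notin> H)))"

text \<open>
  \<open>H\<close>, a subgroup of the fundamental group of \<open>(X, x0)\<close>, is \<open>(T, g)\<close>-closed, where \<open>T\<close> is a
  subgroup and \<open>g\<close> an element of the fundamental group of the test space \<open>(Y, y0)\<close>.
\<close>

definition pi1_closed ::
    "'b::topological_space set \<Rightarrow> 'b \<Rightarrow> (real \<Rightarrow> 'b) set set \<Rightarrow> (real \<Rightarrow> 'b) set \<Rightarrow>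
     'a::topological_space set \<Rightarrow> 'a \<Rightarrow> (real \<Rightarrow> 'a) set set \<Rightarrow> bool" where
  "pi1_closed Y y0 T g X x0 H \<longleftrightarrow>
     (\<forall>f. continuous_on Y f \<and> f ` Y \<subseteq> X \<and> f y0 = x0 \<and> induced_hom X f ` T \<subseteq> H \<longrightarrow>
          induced_hom X f g \<in> H)"

definition D_arc :: "nat \<Rightarrow> nat \<Rightarrow> (real \<times> real) set" where
  "D_arc n j = {(x, y). (x - (2 * real j - 1) / 2^n)\<^sup>2 + y\<^sup>2 = (1 / 2^n)\<^sup>2 \<and> y \<ge> 0}"

definition D_space :: "(real \<times> real) set" where
  "D_space = {0..1} \<times> {0} \<union> (\<Union>n\<in>{1..}. \<Union>j\<in>{1..2^(n-1)}. D_arc n j)"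

definition d0 :: "real \<times> real" where
  "d0 = (0, 0)"

definition ell :: "nat \<Rightarrow> nat \<Rightarrow> real \<Rightarrow> real \<times> real" where
  "ell n j t = ((t + real j - 1) / 2^(n-1), 1 / 2^(n-1) * sqrt (t - t\<^sup>2))"

definition lambda :: "nat \<Rightarrow> real \<Rightarrow> real \<times> real" where
  "lambda n = concat_paths (2^(n-1)) (ell n)"

definition lambda_inf :: "real \<Rightarrow> real \<times> real" where
  "lambda_inf t = (t, 0)"

definition s_elt :: "nat \<Rightarrow> (real \<Rightarrow> real \<times> real) set" where
  "s_elt n = path_class D_space (lambda n +++ reversepath (lambda (n + 1)))"

definition S_group :: "(real \<Rightarrow> real \<times> real) set set" where
  "S_group = generate (fundamental_group D_space d0) {s_elt n | n. n \<ge> 1}"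

definition d_inf :: "(real \<Rightarrow> real \<times> real) set" where
  "d_inf = path_class D_space (lambda 1 +++ reversepath lambda_inf)"

end

theory Submission
  imports Defs
begin

text \<open>
  Two paths \<open>p\<close>, \<open>q\<close> from \<open>x0\<close> with a common end are called congruent if the class of
  \<open>p\<close> followed by the reverse of \<open>q\<close> lies in \<open>H\<close>; as \<open>H\<close> is a subgroup, this is an equivalence
  relation. All the conditions of the theorem speak of it. A map \<open>f\<close> on the test space carries
  \<open>S\<close> into \<open>H\<close> exactly when the paths \<open>f \<circ> lambda 1\<close>, \<open>f \<circ> lambda 2\<close>, \<open>\<dots>\<close> are all congruent, and it
  carries \<open>d_inf\<close> into \<open>H\<close> exactly when \<open>f \<circ> lambda 1\<close> is congruent to \<open>f \<circ> lambda_inf\<close>.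
  Being closed thus says that a congruence class contains the limit of any of its sequences that arises
  from a map on the test space, and being homotopically path Hausdorff says that a path outside a
  class has a neighbourhood free of members of that class (among the paths that agree with it at
  the chosen dyadic points). The theorem compares sequential closedness with closedness.

  The link is that \<open>lambda (k + 1)\<close> is the graph \<open>t \<mapsto> (t, h t)\<close> of a function \<open>h\<close> of
  height at most \<open>1/2^k\<close> which vanishes at the dyadic points of level \<open>k\<close>
  (\<open>lambda_eq_arc_height\<close>), and that graphs of different levels meet only on the base
  (\<open>arc_height_inj\<close>). So a map on the test space is the same as a path \<open>\<alpha>\<close> together with
  paths \<open>\<gamma> k\<close> that agree with \<open>\<alpha>\<close> at the dyadic points of level \<open>k\<close> and converge to \<open>\<alpha>\<close> in the
  compact-open topology: \<open>lambda_tendsto_lambda_inf\<close> is one direction and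
  \<open>continuous_on_D_space_glue\<close> the other.

  If \<open>X\<close> is homotopically path Hausdorff and \<open>f\<close> carries \<open>S\<close> into \<open>H\<close> but not \<open>d_inf\<close>, then for large
  \<open>k\<close> the path \<open>f \<circ> lambda k\<close> lies in the neighbourhood of \<open>f \<circ> lambda_inf\<close> that should
  contain no path congruent to \<open>f \<circ> lambda 1\<close>. Conversely, if the Hausdorff property
  fails at \<open>\<alpha>\<close>, \<open>\<beta>\<close>, one runs through a countable neighbourhood base of \<open>\<alpha>\<close>. The sets of paths that
  map each dyadic interval of some level into a prescribed open set form a base of the path space
  (\<open>dyadic_tubes_form_base\<close>), and the level may be taken as large as desired. Hence each member
  of the base contains a path \<open>\<gamma> k\<close> that is congruent to \<open>\<beta>\<close> and agrees with \<open>\<alpha>\<close> at the dyadic points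
  of level \<open>k\<close>. These glue to a map that violates closedness. The same base of tubes, with metric
  neighbourhoods of the pieces of \<open>\<alpha>\<close>, makes the path space of a metrizable \<open>X\<close> first
  countable.
\<close>


section \<open>The fundamental group and induced homomorphisms\<close>

text \<open>
  Every path is the image of the identity path of the unit interval, which is a line segment. So the
  unit and inverse laws for line segments, pushed forward, hold for paths in any topological space.
\<close>
lemma homotopic_paths_image_of_interval:
  assumes "path p" "path_image p \<subseteq> X" "homotopic_paths {0..1::real} u v"
  shows "homotopic_paths X (p \<circ> u) (p \<circ> v)"
  using homotopic_paths_continuous_image[OF assms(3), of p X] assms(1,2)
  by (auto simp: path_def path_image_def)

lemma homotopic_paths_lid_const:
  fixes p :: "real \<Rightarrow> 'a::topological_space"
  assumes "path p" "path_image p \<subseteq> X"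
  shows "homotopic_paths X ((\<lambda>_. pathstart p) +++ p) p"
proof -
  have "homotopic_paths {0..1} (linepath 0 0 +++ linepath 0 1) (linepath 0 (1::real))"
    using homotopic_paths_lid[of "linepath 0 (1::real)" "{0..1}"]
    by (simp add: closed_segment_eq_real_ivl)
  moreover have "p \<circ> linepath 0 1 = p" "p \<circ> linepath 0 0 = (\<lambda>_. pathstart p)"
    by (auto simp: linepath_def pathstart_def)
  ultimately show ?thesis
    using homotopic_paths_image_of_interval[OF assms] by (metis path_compose_join)
qed

lemma homotopic_paths_linv_const:
  fixes p :: "real \<Rightarrow> 'a::topological_space"
  assumes "path p" "path_image p \<subseteq> X"
  shows "homotopic_paths X (reversepath p +++ p) (\<lambda>_. pathfinish p)"
proof -
  have "homotopic_paths {0..1} (reversepath (linepath 0 1) +++ linepath 0 1) (linepath 1 (1::real))"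
    using homotopic_paths_linv[of "linepath 0 (1::real)" "{0..1}"]
    by (simp add: closed_segment_eq_real_ivl)
  moreover have "p \<circ> linepath 0 1 = p" "p \<circ> linepath 1 1 = (\<lambda>_. pathfinish p)"
    by (auto simp: linepath_def pathfinish_def)
  ultimately show ?thesis
    using homotopic_paths_image_of_interval[OF assms]
    by (metis path_compose_join path_compose_reversepath)
qed

lemma path_class_eqI: "homotopic_paths X p q \<Longrightarrow> path_class X p = path_class X q"
  unfolding path_class_def by (blast intro: homotopic_paths_sym homotopic_paths_trans)

lemma path_class_cong:
  assumes "path p" "path_image p \<subseteq> X" "\<And>t. t \<in> {0..1} \<Longrightarrow> p t = q t"
  shows "path_class X p = path_class X q"
  using assms by (intro path_class_eqI homotopic_paths_eq)

lemma mult_path_class: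
  assumes "path p" "path_image p \<subseteq> X" "path q" "path_image q \<subseteq> X" "pathfinish p = pathstart q"
  shows "path_class X p \<otimes>\<^bsub>fundamental_group X x0\<^esub> path_class X q = path_class X (p +++ q)"
proof -
  have "path_class X (p' +++ q') = path_class X (p +++ q)"
    if "p' \<in> path_class X p" "q' \<in> path_class X q" for p' q'
    using that assms(5) unfolding path_class_def mem_Collect_eq
    by (intro path_class_eqI[symmetric, unfolded path_class_def] homotopic_paths_join)
  moreover have "p \<in> path_class X p" "q \<in> path_class X q"
    using assms by (auto simp: path_class_def)
  ultimately have "(\<Union>p'\<in>path_class X p. \<Union>q'\<in>path_class X q. path_class X (p' +++ q'))
      = path_class X (p +++ q)"
    by (intro SUP_eq_const) blast+
  then show ?thesis
    by (simp add: fundamental_group_def)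
qed

lemma loops_at_iff:
  "p \<in> loops_at X x0 \<longleftrightarrow> path p \<and> path_image p \<subseteq> X \<and> pathstart p = x0 \<and> pathfinish p = x0"
  by (auto simp: loops_at_def paths_from_def)

lemma loops_at_join: "p \<in> loops_at X x0 \<Longrightarrow> q \<in> loops_at X x0 \<Longrightarrow> p +++ q \<in> loops_at X x0"
  by (simp add: loops_at_iff subset_path_image_join)

lemma carrier_fundamental_group: "carrier (fundamental_group X x0) = path_class X ` loops_at X x0"
  by (simp add: fundamental_group_def)

lemma one_fundamental_group: "\<one>\<^bsub>fundamental_group X x0\<^esub> = path_class X (\<lambda>_. x0)"
  by (simp add: fundamental_group_def)

lemma const_loop: "x0 \<in> X \<Longrightarrow> (\<lambda>_. x0) \<in> loops_at X x0"
  by (auto simp: loops_at_iff path_def path_image_def pathstart_def pathfinish_def)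

lemma mult_loop_class:
  assumes "p \<in> loops_at X x0" "q \<in> loops_at X x0"
  shows "path_class X p \<otimes>\<^bsub>fundamental_group X x0\<^esub> path_class X q = path_class X (p +++ q)"
  using assms by (intro mult_path_class) (auto simp: loops_at_iff)

lemma linv_loop_class:
  assumes "p \<in> loops_at X x0"
  shows "path_class X (reversepath p) \<otimes>\<^bsub>fundamental_group X x0\<^esub> path_class X p
           = \<one>\<^bsub>fundamental_group X x0\<^esub>"
  using assms homotopic_paths_linv_const[of p X]
  by (subst mult_path_class) (auto simp: loops_at_iff one_fundamental_group intro!: path_class_eqI)

lemma group_fundamental_group:
  assumes "x0 \<in> X"
  shows "group (fundamental_group X x0)"
proof (rule groupI)
  show "\<one>\<^bsub>fundamental_group X x0\<^esub> \<in> carrier (fundamental_group X x0)"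
    using const_loop[OF assms] by (auto simp: carrier_fundamental_group one_fundamental_group)
next
  fix A assume "A \<in> carrier (fundamental_group X x0)"
  then obtain p where p: "p \<in> loops_at X x0" "A = path_class X p"
    by (auto simp: carrier_fundamental_group)
  show "\<one>\<^bsub>fundamental_group X x0\<^esub> \<otimes>\<^bsub>fundamental_group X x0\<^esub> A = A"
    unfolding one_fundamental_group p(2) mult_loop_class[OF const_loop[OF assms] p(1)]
    using p(1) homotopic_paths_lid_const[of p X]
    by (intro path_class_eqI) (auto simp: loops_at_iff)
  have "reversepath p \<in> loops_at X x0"
    using p(1) by (simp add: loops_at_iff)
  with linv_loop_class[OF p(1)]
  show "\<exists>B\<in>carrier (fundamental_group X x0).
          B \<otimes>\<^bsub>fundamental_group X x0\<^esub> A = \<one>\<^bsub>fundamental_group X x0\<^esub>"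
    unfolding p(2) carrier_fundamental_group by blast
next
  fix A B C
  assume "A \<in> carrier (fundamental_group X x0)" "B \<in> carrier (fundamental_group X x0)"
    "C \<in> carrier (fundamental_group X x0)"
  then obtain p q r where pqr: "p \<in> loops_at X x0" "q \<in> loops_at X x0" "r \<in> loops_at X x0"
    "A = path_class X p" "B = path_class X q" "C = path_class X r"
    by (auto simp: carrier_fundamental_group)
  have "homotopic_paths X (p +++ (q +++ r)) ((p +++ q) +++ r)"
    using pqr(1-3) by (intro homotopic_paths_assoc) (auto simp: loops_at_iff)
  then show "A \<otimes>\<^bsub>fundamental_group X x0\<^esub> B \<otimes>\<^bsub>fundamental_group X x0\<^esub> C
      = A \<otimes>\<^bsub>fundamental_group X x0\<^esub> (B \<otimes>\<^bsub>fundamental_group X x0\<^esub> C)"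
    using pqr by (simp add: mult_loop_class loops_at_join path_class_eqI)
qed (auto simp: carrier_fundamental_group mult_loop_class loops_at_join)

lemma inv_loop_class:
  assumes "p \<in> loops_at X x0"
  shows "inv\<^bsub>fundamental_group X x0\<^esub> (path_class X p) = path_class X (reversepath p)"
proof -
  have "x0 \<in> X"
    using assms by (auto simp: loops_at_iff)
  with assms show ?thesis
    by (intro group.inv_equality group_fundamental_group linv_loop_class)
       (auto simp: carrier_fundamental_group loops_at_iff)
qed

lemma induced_hom_path_class:
  assumes "continuous_on Y f" "f ` Y \<subseteq> X" "path p" "path_image p \<subseteq> Y"
  shows "induced_hom X f (path_class Y p) = path_class X (f \<circ> p)"
proof -
  have "path_class X (f \<circ> q) = path_class X (f \<circ> p)" if "q \<in> path_class Y p" for q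
    using that assms homotopic_paths_continuous_image[of Y p q f X]
    by (auto simp: path_class_def intro!: path_class_eqI[symmetric, unfolded path_class_def])
  moreover have "p \<in> path_class Y p"
    using assms by (auto simp: path_class_def)
  ultimately show ?thesis
    unfolding induced_hom_def by (intro SUP_eq_const) blast+
qed

lemma induced_hom_is_hom:
  assumes "continuous_on Y f" "f ` Y \<subseteq> X" "f y0 = x0"
  shows "induced_hom X f \<in> hom (fundamental_group Y y0) (fundamental_group X x0)"
proof (rule homI)
  have loop: "f \<circ> p \<in> loops_at X x0" if "p \<in> loops_at Y y0" for p
    using that assms
    by (auto simp: loops_at_iff path_image_compose pathstart_compose pathfinish_compose
        intro!: path_continuous_image intro: continuous_on_subset)
  have ind: "induced_hom X f (path_class Y p) = path_class X (f \<circ> p)" if "p \<in> loops_at Y y0" for p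
    using that assms by (intro induced_hom_path_class) (auto simp: loops_at_iff)
  show "induced_hom X f A \<in> carrier (fundamental_group X x0)"
    if "A \<in> carrier (fundamental_group Y y0)" for A
    using that loop ind by (auto simp: carrier_fundamental_group)
  show "induced_hom X f (A \<otimes>\<^bsub>fundamental_group Y y0\<^esub> B)
      = induced_hom X f A \<otimes>\<^bsub>fundamental_group X x0\<^esub> induced_hom X f B"
    if "A \<in> carrier (fundamental_group Y y0)" "B \<in> carrier (fundamental_group Y y0)" for A B
    using that
    by (auto simp: carrier_fundamental_group mult_loop_class loop ind loops_at_join path_compose_join)
qed

text \<open>A homomorphism carries a generated subgroup into a subgroup as soon as it does so on generators.\<close>
lemma (in group_hom) image_generate_subset:
  assumes "K \<subseteq> carrier G" "subgroup L H" "h ` K \<subseteq> L"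
  shows "h ` generate G K \<subseteq> L"
  using H.generate_subgroup_incl[OF assms(3,2)] generate_img[OF assms(1)] by simp

section \<open>Congruence of paths modulo a subgroup\<close>

text \<open>
  For paths with the same start and the same end this means that \<open>[p]\<close> lies in the coset \<open>H [q]\<close>,
  formed in the fundamental groupoid.
\<close>
definition congruent_paths :: "'a::topological_space set \<Rightarrow> (real \<Rightarrow> 'a) set set \<Rightarrow>
    (real \<Rightarrow> 'a) \<Rightarrow> (real \<Rightarrow> 'a) \<Rightarrow> bool" where
  "congruent_paths X H p q \<longleftrightarrow> path_class X (p +++ reversepath q) \<in> H"

lemma join_reversepath_in_loops_at:
  assumes "p \<in> paths_from X x0" "q \<in> paths_from X x0" "pathfinish p = pathfinish q"
  shows "p +++ reversepath q \<in> loops_at X x0"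
  using assms by (simp add: paths_from_def loops_at_iff subset_path_image_join)

lemma congruent_paths_refl:
  assumes "subgroup H (fundamental_group X x0)" "p \<in> paths_from X x0"
  shows "congruent_paths X H p p"
proof -
  have "homotopic_paths X (p +++ reversepath p) (\<lambda>_. x0)"
    using homotopic_paths_linv_const[of "reversepath p" X] assms(2)
    by (simp add: paths_from_def)
  from path_class_eqI[OF this] subgroup.one_closed[OF assms(1)] show ?thesis
    by (simp add: congruent_paths_def one_fundamental_group)
qed

lemma congruent_paths_sym:
  assumes "subgroup H (fundamental_group X x0)" "p \<in> paths_from X x0" "q \<in> paths_from X x0"
    "pathfinish p = pathfinish q" "congruent_paths X H p q"
  shows "congruent_paths X H q p"
proof -
  have "reversepath (p +++ reversepath q) = q +++ reversepath p"
    using assms(4) by (simp add: reversepath_joinpaths)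
  with inv_loop_class[OF join_reversepath_in_loops_at[OF assms(2-4)]]
    subgroup.m_inv_closed[OF assms(1) assms(5)[unfolded congruent_paths_def]]
  show ?thesis
    by (simp add: congruent_paths_def)
qed

text \<open>The product of \<open>[p \<cdot> q\<^sup>-]\<close> and \<open>[q \<cdot> r\<^sup>-]\<close> is \<open>[p \<cdot> r\<^sup>-]\<close>, because \<open>q\<^sup>- \<cdot> q\<close> contracts.\<close>
lemma congruent_paths_trans:
  assumes "subgroup H (fundamental_group X x0)"
    "p \<in> paths_from X x0" "q \<in> paths_from X x0" "r \<in> paths_from X x0"
    "pathfinish p = pathfinish q" "pathfinish q = pathfinish r"
    "congruent_paths X H p q" "congruent_paths X H q r"
  shows "congruent_paths X H p r"
proof -
  note paths = assms(2-6)[unfolded paths_from_def mem_Collect_eq]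
  have "homotopic_paths X ((p +++ reversepath q) +++ (q +++ reversepath r))
          (p +++ (reversepath q +++ (q +++ reversepath r)))"
    by (rule homotopic_paths_sym, rule homotopic_paths_assoc) (simp_all add: paths subset_path_image_join)
  also have "homotopic_paths X (p +++ (reversepath q +++ (q +++ reversepath r)))
               (p +++ ((reversepath q +++ q) +++ reversepath r))"
    by (rule homotopic_paths_join, simp add: paths, rule homotopic_paths_assoc)
       (simp_all add: paths subset_path_image_join)
  also have "homotopic_paths X (p +++ ((reversepath q +++ q) +++ reversepath r))
               (p +++ ((\<lambda>_. pathfinish q) +++ reversepath r))"
    by (intro homotopic_paths_join homotopic_paths_linv_const) (simp_all add: paths)
  also have "homotopic_paths X (p +++ ((\<lambda>_. pathfinish q) +++ reversepath r))
               (p +++ reversepath r)"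
    using homotopic_paths_lid_const[of "reversepath r" X]
    by (intro homotopic_paths_join) (simp_all add: paths, simp_all add: pathstart_def)
  finally have "path_class X ((p +++ reversepath q) +++ (q +++ reversepath r))
      = path_class X (p +++ reversepath r)"
    by (rule path_class_eqI)
  moreover have "path_class X (p +++ reversepath q) \<otimes>\<^bsub>fundamental_group X x0\<^esub>
      path_class X (q +++ reversepath r) = path_class X ((p +++ reversepath q) +++ (q +++ reversepath r))"
    by (intro mult_loop_class join_reversepath_in_loops_at assms(2-6))
  ultimately show ?thesis
    using subgroup.m_closed[OF assms(1) assms(7,8)[unfolded congruent_paths_def]]
    by (simp add: congruent_paths_def)
qed

lemma congruent_paths_cong:
  assumes "path p" "path_image p \<subseteq> X" "path q" "path_image q \<subseteq> X" "pathfinish p = pathfinish q"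
    and "\<And>t. t \<in> {0..1} \<Longrightarrow> p t = p' t" "\<And>t. t \<in> {0..1} \<Longrightarrow> q t = q' t"
  shows "congruent_paths X H p q \<longleftrightarrow> congruent_paths X H p' q'"
proof -
  have "path_class X (p +++ reversepath q) = path_class X (p' +++ reversepath q')"
    by (rule path_class_cong)
       (simp_all add: assms subset_path_image_join, simp add: assms joinpaths_def reversepath_def)
  then show ?thesis
    by (simp add: congruent_paths_def)
qed

lemma compose_in_paths_from:
  assumes "continuous_on Y f" "f ` Y \<subseteq> X" "f y0 = x0" "p \<in> paths_from Y y0"
  shows "f \<circ> p \<in> paths_from X x0"
  using assms
  by (auto simp: paths_from_def path_image_compose pathstart_compose
      intro!: path_continuous_image intro: continuous_on_subset)

text \<open>Turns every membership in \<open>H\<close> of the image of some \<open>s_elt n\<close> or of \<open>d_inf\<close> into a congruence.\<close>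
lemma induced_hom_mem_iff_congruent:
  assumes "continuous_on Y f" "f ` Y \<subseteq> X"
    and "p \<in> paths_from Y y0" "q \<in> paths_from Y y0" "pathfinish p = pathfinish q"
  shows "induced_hom X f (path_class Y (p +++ reversepath q)) \<in> H \<longleftrightarrow>
         congruent_paths X H (f \<circ> p) (f \<circ> q)"
proof -
  have "p +++ reversepath q \<in> loops_at Y y0"
    by (rule join_reversepath_in_loops_at) (fact assms)+
  then have "induced_hom X f (path_class Y (p +++ reversepath q))
      = path_class X (f \<circ> (p +++ reversepath q))"
    using assms(1,2) by (intro induced_hom_path_class) (auto simp: loops_at_iff)
  then show ?thesis
    by (simp add: congruent_paths_def path_compose_join path_compose_reversepath)
qed

section \<open>The test space as a union of graphs\<close>

definition dyadic_interval :: "nat \<Rightarrow> nat \<Rightarrow> real set" where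
  "dyadic_interval k j = {(real j - 1) / 2^k .. real j / 2^k}"

lemma dyadic_interval_subset_unit:
  assumes "j \<in> {1..2^k}"
  shows "dyadic_interval k j \<subseteq> {0..1}"
proof -
  have "real j \<le> 2^k"
    using assms by (metis atLeastAtMost_iff of_nat_le_iff of_nat_numeral of_nat_power)
  moreover have "0 \<le> (real j - 1) / 2^k"
    using assms by simp
  ultimately show ?thesis
    by (auto simp: dyadic_interval_def field_simps intro: order_trans)
qed

lemma unit_interval_dyadic_cover:
  assumes "t \<in> {0..1}"
  obtains j where "j = max 1 (nat \<lceil>2^k * t\<rceil>)" "j \<in> {1..2^k}" "t \<in> dyadic_interval k j"
proof
  let ?j = "max 1 (nat \<lceil>2^k * t\<rceil>)"
  have "\<lceil>2^k * t\<rceil> \<le> 2^k"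
    using assms by (simp add: ceiling_le_iff)
  then have "nat \<lceil>2^k * t\<rceil> \<le> nat (2^k)"
    by (rule nat_mono)
  then show "?j \<in> {1..2^k}"
    by (simp add: nat_power_eq)
  have t0: "0 \<le> 2^k * t"
    using assms by simp
  have "real ?j - 1 \<le> 2^k * t" "2^k * t \<le> real ?j"
    using t0 by linarith+
  then show "t \<in> dyadic_interval k ?j"
    by (simp add: dyadic_interval_def field_simps)
qed simp

text \<open>
  The height over \<open>x\<close> of the row of semicircles of diameter \<open>1/2^k\<close>: over an interval \<open>{a..b}\<close> of
  that length the semicircle is \<open>y\<^sup>2 = (x - a) (b - x)\<close>, and with \<open>u\<close> the fractional part of
  \<open>2^k x\<close> this is \<open>u (1 - u)\<close> up to the factor \<open>1/4^k\<close>. The levels start at \<open>0\<close>, so level \<open>k\<close>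
  belongs to \<open>lambda (Suc k)\<close>.
\<close>
definition arc_height :: "nat \<Rightarrow> real \<Rightarrow> real" where
  "arc_height k x = sqrt (frac (2^k * x) * (1 - frac (2^k * x))) / 2^k"

text \<open>
  At the right end the fractional part jumps to \<open>0\<close>, but \<open>u (1 - u)\<close> has the same
  value at \<open>u = 0\<close> and \<open>u = 1\<close>; therefore the closed interval is allowed.
\<close>
lemma frac_parabola:
  assumes "of_int i \<le> u" "u \<le> of_int i + (1::real)"
  shows "frac u * (1 - frac u) = (u - of_int i) * (of_int i + 1 - u)"
proof (cases "u = of_int i + 1")
  case True
  then have "u \<in> \<int>" by simp
  then have "frac u = 0" by simp
  with True show ?thesis by simp
next
  case False
  then have "frac u = u - of_int i"
    using assms by (simp add: frac_unique_iff)
  then show ?thesis by simp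
qed

lemma arc_height_on_dyadic_interval:
  assumes "x \<in> dyadic_interval k j"
  shows "arc_height k x = sqrt ((x - (real j - 1) / 2^k) * (real j / 2^k - x))"
proof -
  have "real j - 1 \<le> 2^k * x" "2^k * x \<le> real j"
    using assms by (simp_all add: dyadic_interval_def field_simps)
  then have "frac (2^k * x) * (1 - frac (2^k * x)) = (2^k * x - (real j - 1)) * (real j - 2^k * x)"
    using frac_parabola[of "int j - 1" "2^k * x"] by simp
  also have "\<dots> = ((x - (real j - 1) / 2^k) * (real j / 2^k - x)) * (2^k)\<^sup>2"
    by (simp add: field_simps power2_eq_square)
  finally show ?thesis
    by (simp add: arc_height_def real_sqrt_mult)
qed

lemma lambda_eq_arc_height:
  assumes "t \<in> {0..1}"
  shows "lambda (Suc k) t = (t, arc_height k t)"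
proof -
  obtain j where j: "j = max 1 (nat \<lceil>2^k * t\<rceil>)" "j \<in> {1..2^k}" "t \<in> dyadic_interval k j"
    using unit_interval_dyadic_cover[OF assms] .
  define s where "s = 2^k * t - (real j - 1)"
  have "lambda (Suc k) t = ell (Suc k) j s"
    by (simp add: lambda_def concat_paths_def Let_def s_def j(1))
  moreover have "s - s\<^sup>2 = ((t - (real j - 1) / 2^k) * (real j / 2^k - t)) * (2^k)\<^sup>2"
    by (simp add: s_def field_simps power2_eq_square)
  ultimately show ?thesis
    by (simp add: ell_def arc_height_on_dyadic_interval[OF j(3)] real_sqrt_mult s_def)
qed

lemma continuous_on_arc_height: "continuous_on {0..1} (arc_height k)"
proof -
  have "continuous_on (\<Union>j\<in>{1..2^k}. dyadic_interval k j) (arc_height k)"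
  proof (rule continuous_on_closed_Union)
    fix j
    have "continuous_on (dyadic_interval k j)
            (\<lambda>x. sqrt ((x - (real j - 1) / 2^k) * (real j / 2^k - x)))"
      by (intro continuous_intros)
    then show "continuous_on (dyadic_interval k j) (arc_height k)"
      by (rule continuous_on_eq) (simp add: arc_height_on_dyadic_interval)
  qed (auto simp: dyadic_interval_def)
  then show ?thesis
    by (rule continuous_on_subset) (blast elim: unit_interval_dyadic_cover)
qed

lemma arc_height_nonneg: "0 \<le> arc_height k x"
  using frac_lt_1[of "2^k * x"] by (simp add: arc_height_def)

lemma arc_height_le: "arc_height k x \<le> 1 / 2^k"
proof -
  have "frac (2^k * x) * (1 - frac (2^k * x)) \<le> 1"
    using frac_lt_1[of "2^k * x"] frac_ge_0[of "2^k * x"] by (intro mult_le_one) auto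
  then show ?thesis
    by (simp add: arc_height_def divide_right_mono)
qed

lemma arc_height_eq_0_iff: "arc_height k x = 0 \<longleftrightarrow> 2^k * x \<in> \<int>"
  using frac_lt_1[of "2^k * x"] by (simp add: arc_height_def)

lemma arc_height_dyadic_point:
  assumes "k \<le> l"
  shows "arc_height l (real j / 2^k) = 0"
proof -
  have "(2::real)^l = 2^(l - k) * 2^k"
    using assms by (simp add: power_add[symmetric])
  then have "2^l * (real j / 2^k) = of_nat (2^(l - k) * j)"
    by simp
  then show ?thesis
    unfolding arc_height_eq_0_iff by (metis Ints_of_nat)
qed

lemma zero_arc_height_is_dyadic:
  assumes "arc_height k x = 0" "x \<in> {0..1}"
  obtains j where "j \<in> {0..2^k}" "x = real j / 2^k"
proof -
  obtain i where i: "2^k * x = of_int i"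
    using assms(1) by (auto simp: arc_height_eq_0_iff elim: Ints_cases)
  have "0 \<le> 2^k * x" "2^k * x \<le> 2^k"
    using assms(2) by auto
  then have "0 \<le> i" "real_of_int i \<le> of_int (2^k)"
    using i by auto
  then have "0 \<le> i" "i \<le> 2^k"
    by (auto simp only: of_int_le_iff)
  then have "nat i \<in> {0..2^k}"
    by (simp add: nat_le_iff)
  moreover have "x = real (nat i) / 2^k"
    using i \<open>0 \<le> i\<close> by (simp add: field_simps)
  ultimately show ?thesis ..
qed

text \<open>
  A semicircle lies above the two semicircles over the halves of its diameter. With \<open>f\<close> the
  fractional part of \<open>2^k x\<close>, the point \<open>x\<close> is in the left half iff \<open>2 f < 1\<close>, and the strict
  claim reduces to \<open>f (1 - 2 f) / 2 < f (1 - f)\<close>, respectively \<open>(2 f - 1) (1 - f) / 2 < f (1 - f)\<close>,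
  for \<open>0 < f < 1\<close>.
\<close>
lemma arc_height_Suc:
  "arc_height (Suc k) x \<le> arc_height k x" (is ?le)
  "arc_height k x > 0 \<Longrightarrow> arc_height (Suc k) x < arc_height k x" (is "_ \<Longrightarrow> ?less")
proof -
  define f where "f = frac (2^k * x)"
  have f: "0 \<le> f" "f < 1"
    by (simp_all add: f_def frac_lt_1)
  have double: "frac (2^Suc k * x) = (if 2 * f < 1 then 2 * f else 2 * f - 1)"
  proof -
    have "2^Suc k * x = 2^k * x + 2^k * x"
      by simp
    then show ?thesis
      by (simp only: frac_add f_def mult_2)
  qed
  have Suc: "arc_height (Suc k) x = sqrt ((if 2 * f < 1 then f * (1 - 2 * f) / 2 else (2 * f - 1) * (1 - f) / 2)) / 2^k"
  proof -
    have "sqrt (frac (2^Suc k * x) * (1 - frac (2^Suc k * x))) / 2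
        = sqrt (frac (2^Suc k * x) * (1 - frac (2^Suc k * x)) / 4)"
      by (simp add: real_sqrt_divide)
    also have "frac (2^Suc k * x) * (1 - frac (2^Suc k * x)) / 4
        = (if 2 * f < 1 then f * (1 - 2 * f) / 2 else (2 * f - 1) * (1 - f) / 2)"
      unfolding double by (simp add: field_simps)
    finally show ?thesis
      unfolding arc_height_def by (simp add: field_simps)
  qed
  have base: "arc_height k x = sqrt (f * (1 - f)) / 2^k"
    by (simp add: arc_height_def f_def)
  have "f * (1 - 2 * f) / 2 \<le> f * (1 - f)" "(2 * f - 1) * (1 - f) / 2 \<le> f * (1 - f)"
    using f by (auto simp: divide_simps algebra_simps intro: mult_right_mono)
  then show ?le
    unfolding Suc base by (simp add: divide_right_mono)
  assume "arc_height k x > 0"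
  then have "f > 0"
    using f unfolding base by (metis less_eq_real_def mult_zero_left real_sqrt_zero div_0 less_irrefl)
  then have "f * (1 - 2 * f) < f * (1 - f)" "(2 * f - 1) * (1 - f) < (2 * f) * (1 - f)"
    using f by (auto intro!: mult_strict_right_mono mult_strict_left_mono)
  moreover have "0 < f * (1 - f)" "0 < (2 * f) * (1 - f)"
    using \<open>f > 0\<close> f by auto
  ultimately have "f * (1 - 2 * f) / 2 < f * (1 - f)" "(2 * f - 1) * (1 - f) / 2 < f * (1 - f)"
    by (auto simp: field_simps)
  then show ?less
    unfolding Suc base by (simp add: divide_strict_right_mono)
qed

text \<open>Above the base the levels are disjoint: over a fixed point the positive heights strictly decrease.\<close>
lemma arc_height_inj:
  assumes "arc_height k x = arc_height l x" "arc_height k x > 0"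
  shows "k = l"
proof -
  have False if "a < b" "arc_height a x = arc_height b x" "arc_height a x > 0" for a b
  proof -
    have "arc_height b x \<le> arc_height (Suc a) x"
      by (rule lift_Suc_antimono_le[of "\<lambda>k. arc_height k x"]) (use that(1) arc_height_Suc in auto)
    also have "\<dots> < arc_height a x"
      using that(3) by (rule arc_height_Suc)
    finally show False
      using that(2) by simp
  qed
  with assms show ?thesis
    by (metis linorder_neqE_nat)
qed

lemma mem_D_arc_iff:
  "(x, y) \<in> D_arc (Suc k) j \<longleftrightarrow> x \<in> dyadic_interval k j \<and> y = arc_height k x"
proof -
  define a b where "a = (real j - 1) / 2^k" and "b = real j / 2^k"
  have centre: "(x - (2 * real j - 1) / 2^Suc k)\<^sup>2 = (1 / 2^Suc k)\<^sup>2 - (x - a) * (b - x)"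
    by (simp add: a_def b_def field_simps power2_eq_square)
  have "(x, y) \<in> D_arc (Suc k) j \<longleftrightarrow> y\<^sup>2 = (x - a) * (b - x) \<and> y \<ge> 0"
    unfolding D_arc_def mem_Collect_eq prod.case centre by linarith
  also have "\<dots> \<longleftrightarrow> 0 \<le> (x - a) * (b - x) \<and> y = sqrt ((x - a) * (b - x))"
    using real_sqrt_unique[of y "(x - a) * (b - x)"] zero_le_power2[of y] by auto
  also have "0 \<le> (x - a) * (b - x) \<longleftrightarrow> x \<in> {a..b}"
  proof -
    have "a < b"
      by (simp add: a_def b_def divide_strict_right_mono)
    then show ?thesis
      by (auto simp: zero_le_mult_iff)
  qed
  also have "{a..b} = dyadic_interval k j"
    by (simp add: dyadic_interval_def a_def b_def)
  finally show ?thesis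
    using arc_height_on_dyadic_interval[of x k j] by (auto simp: a_def b_def)
qed

lemma mem_D_space_iff:
  "(x, y) \<in> D_space \<longleftrightarrow> x \<in> {0..1} \<and> (y = 0 \<or> (\<exists>k. y = arc_height k x))"
proof
  assume "(x, y) \<in> D_space"
  then consider "x \<in> {0..1}" "y = 0" | n j where "n \<ge> 1" "j \<in> {1..2^(n-1)}" "(x, y) \<in> D_arc n j"
    by (auto simp: D_space_def)
  then show "x \<in> {0..1} \<and> (y = 0 \<or> (\<exists>k. y = arc_height k x))"
  proof cases
    case 2
    then obtain k where "n = Suc k"
      by (cases n) auto
    with 2 show ?thesis
      using dyadic_interval_subset_unit[of j k] by (auto simp: mem_D_arc_iff)
  qed simp
next
  assume xy: "x \<in> {0..1} \<and> (y = 0 \<or> (\<exists>k. y = arc_height k x))"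
  show "(x, y) \<in> D_space"
  proof (cases "y = 0")
    case True
    with xy show ?thesis by (simp add: D_space_def)
  next
    case False
    with xy obtain k where k: "y = arc_height k x" by blast
    obtain j where "j \<in> {1..2^k}" "x \<in> dyadic_interval k j"
      using xy unit_interval_dyadic_cover by metis
    then have "Suc k \<in> {1..}" "j \<in> {1..2^(Suc k - 1)}" "(x, y) \<in> D_arc (Suc k) j"
      using k by (auto simp: mem_D_arc_iff)
    then show ?thesis
      unfolding D_space_def by blast
  qed
qed

lemma lambda_path:
  "path (lambda (Suc k))" "path_image (lambda (Suc k)) \<subseteq> D_space"
  "pathstart (lambda (Suc k)) = d0" "pathfinish (lambda (Suc k)) = (1, 0)"
proof -
  have "continuous_on {0..1} (\<lambda>t. (t, arc_height k t))"
    by (intro continuous_intros continuous_on_arc_height)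
  then have "continuous_on {0..1} (lambda (Suc k))"
    by (rule continuous_on_eq) (rule lambda_eq_arc_height[symmetric])
  then show "path (lambda (Suc k))"
    by (simp add: path_def)
  show "path_image (lambda (Suc k)) \<subseteq> D_space"
    by (auto simp: path_image_def lambda_eq_arc_height mem_D_space_iff)
  show "pathstart (lambda (Suc k)) = d0" "pathfinish (lambda (Suc k)) = (1, 0)"
    using arc_height_dyadic_point[of 0 k 0] arc_height_dyadic_point[of 0 k 1]
    by (simp_all add: pathstart_def pathfinish_def lambda_eq_arc_height d0_def)
qed

lemma lambda_inf_path:
  "path lambda_inf" "path_image lambda_inf \<subseteq> D_space"
  "pathstart lambda_inf = d0" "pathfinish lambda_inf = (1, 0)"
proof -
  have "continuous_on {0..1} (\<lambda>t::real. (t, 0::real))"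
    by (intro continuous_intros)
  moreover have "lambda_inf = (\<lambda>t. (t, 0))"
    by (simp add: fun_eq_iff lambda_inf_def)
  ultimately show "path lambda_inf"
    unfolding path_def by metis
  show "path_image lambda_inf \<subseteq> D_space"
    by (auto simp: path_image_def lambda_inf_def mem_D_space_iff)
qed (simp_all add: pathstart_def pathfinish_def lambda_inf_def d0_def)

section \<open>Maps on the test space\<close>

text \<open>
  At a point \<open>(x, y)\<close> each single graph is harmless: either it passes through the point, and the
  continuous path on it controls \<open>f\<close>, or it is closed and misses a neighbourhood of the point. Only
  the tail of the sequence of graphs must be treated uniformly. If \<open>y > 0\<close>, a neighbourhood of the
  point meets none of the flat graphs of high level; if \<open>y = 0\<close>, hypothesis \<open>lim\<close>, the locally
  uniform convergence of \<open>\<gamma> k\<close> to \<open>\<alpha>\<close>, controls them.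
\<close>
lemma continuous_on_D_space_glue:
  fixes f :: "real \<times> real \<Rightarrow> 'a::topological_space"
  assumes \<alpha>: "continuous_on {0..1} \<alpha>" and \<gamma>: "\<And>k. continuous_on {0..1} (\<gamma> k)"
    and base: "\<And>x. x \<in> {0..1} \<Longrightarrow> f (x, 0) = \<alpha> x"
    and arc: "\<And>k x. x \<in> {0..1} \<Longrightarrow> f (x, arc_height k x) = \<gamma> k x"
    and lim: "\<And>x U. x \<in> {0..1} \<Longrightarrow> open U \<Longrightarrow> \<alpha> x \<in> U \<Longrightarrow>
      \<exists>e>0. \<forall>\<^sub>F k in sequentially. \<forall>t\<in>{0..1}. dist t x < e \<longrightarrow> \<gamma> k t \<in> U"
  shows "continuous_on D_space f"
  unfolding continuous_on_def
proof (intro ballI topological_tendstoI)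
  fix p U assume p: "p \<in> D_space" and U: "open U" "f p \<in> U"
  obtain x y where xy: "p = (x, y)" by (cases p)
  have x: "x \<in> {0..1}" and y: "y = 0 \<or> (\<exists>k. y = arc_height k x)"
    using p by (auto simp: xy mem_D_space_iff)
  define F where "F = at p within D_space"
  have fst_lim: "(fst \<longlongrightarrow> x) F" and snd_lim: "(snd \<longlongrightarrow> y) F"
    unfolding F_def xy by (auto intro!: tendsto_eq_intros)
  have fst_in: "\<forall>\<^sub>F q in F. fst q \<in> {0..1}"
    unfolding F_def eventually_at_filter by (intro always_eventually) (auto simp: mem_D_space_iff)
  have along: "((\<lambda>q. h (fst q)) \<longlongrightarrow> h x) F" if "continuous_on {0..1} h"
    for h :: "real \<Rightarrow> 'c::topological_space"
    using that fst_lim x fst_in by (rule continuous_on_tendsto_compose)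
  \<comment> \<open>used for the base, where \<open>h\<close> is \<open>0\<close>, and for each level\<close>
  have graph: "\<forall>\<^sub>F q in F. snd q = h (fst q) \<longrightarrow> g (fst q) \<in> U"
    if h: "continuous_on {0..1} h" and g: "continuous_on {0..1} g" and "y = h x \<Longrightarrow> g x \<in> U"
    for h :: "real \<Rightarrow> real" and g
  proof (cases "y = h x")
    case True
    then show ?thesis
      using topological_tendstoD[OF along[OF g] U(1)] that(3) by (auto elim: eventually_mono)
  next
    case False
    have "((\<lambda>q. snd q - h (fst q)) \<longlongrightarrow> y - h x) F"
      by (intro tendsto_diff snd_lim along h)
    then have "\<forall>\<^sub>F q in F. snd q - h (fst q) \<noteq> 0"
      using False by (intro tendsto_imp_eventually_ne) auto
    then show ?thesis
      by eventually_elim simp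
  qed
  have ev_base: "\<forall>\<^sub>F q in F. snd q = 0 \<longrightarrow> \<alpha> (fst q) \<in> U"
  proof (rule graph)
    show "\<alpha> x \<in> U" if "y = 0"
      using U(2) base[OF x] by (simp add: xy that)
  qed (auto intro: \<alpha>)
  have ev_arc: "\<forall>\<^sub>F q in F. snd q = arc_height k (fst q) \<longrightarrow> \<gamma> k (fst q) \<in> U" for k
  proof (rule graph[OF continuous_on_arc_height \<gamma>])
    show "\<gamma> k x \<in> U" if "y = arc_height k x"
      using U(2) arc[OF x] by (simp add: xy that)
  qed
  have "\<exists>N. \<forall>\<^sub>F q in F. \<forall>k\<ge>N. snd q = arc_height k (fst q) \<longrightarrow> \<gamma> k (fst q) \<in> U"
  proof (cases "y = 0")
    case True
    then have "\<alpha> x \<in> U"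
      using U(2) base[OF x] by (simp add: xy)
    from lim[OF x U(1) this] obtain e N where "e > 0"
      and N: "\<And>k t. k \<ge> N \<Longrightarrow> t \<in> {0..1} \<Longrightarrow> dist t x < e \<Longrightarrow> \<gamma> k t \<in> U"
      unfolding eventually_sequentially by blast
    have "\<forall>\<^sub>F q in F. dist (fst q) x < e"
      using fst_lim \<open>e > 0\<close> by (rule tendstoD)
    with fst_in have "\<forall>\<^sub>F q in F. \<forall>k\<ge>N. snd q = arc_height k (fst q) \<longrightarrow> \<gamma> k (fst q) \<in> U"
      by eventually_elim (blast intro: N)
    then show ?thesis ..
  next
    case False
    with y have "y > 0"
      using arc_height_nonneg by (metis less_eq_real_def)
    then obtain N :: nat where N: "(1/2)^N < y / 2"
      using real_arch_pow_inv[of "y / 2" "1/2"] by auto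
    have "\<forall>\<^sub>F q in F. y / 2 < snd q"
      using snd_lim \<open>y > 0\<close> by (intro order_tendstoD(1)) auto
    then have "\<forall>\<^sub>F q in F. \<forall>k\<ge>N. snd q = arc_height k (fst q) \<longrightarrow> \<gamma> k (fst q) \<in> U"
    proof eventually_elim
      case (elim q)
      have "snd q \<noteq> arc_height k (fst q)" if "k \<ge> N" for k
      proof -
        have "arc_height k (fst q) \<le> (1/2)^k"
          using arc_height_le by (simp add: power_one_over)
        also have "\<dots> \<le> (1/2)^N"
          using that by (intro power_decreasing) auto
        finally show ?thesis
          using N elim by simp
      qed
      then show ?case by blast
    qed
    then show ?thesis ..
  qed
  then obtain N where
    tail: "\<forall>\<^sub>F q in F. \<forall>k\<ge>N. snd q = arc_height k (fst q) \<longrightarrow> \<gamma> k (fst q) \<in> U" ..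
  have head: "\<forall>\<^sub>F q in F. \<forall>k\<in>{..<N}. snd q = arc_height k (fst q) \<longrightarrow> \<gamma> k (fst q) \<in> U"
    using ev_arc by (intro eventually_ball_finite) auto
  have "\<forall>\<^sub>F q in F. q \<in> D_space"
    unfolding F_def eventually_at_filter by (intro always_eventually) auto
  then have "\<forall>\<^sub>F q in F. f q \<in> U"
    using tail head ev_base
  proof eventually_elim
    case (elim q)
    obtain s t where q: "q = (s, t)" by (cases q)
    with elim(1) have s: "s \<in> {0..1}" and "t = 0 \<or> (\<exists>k. t = arc_height k s)"
      by (auto simp: mem_D_space_iff)
    then consider "t = 0" | k where "t = arc_height k s" by blast
    then show ?case
    proof cases
      case 1
      then show ?thesis using elim(4) base[OF s] by (simp add: q)
    next
      case (2 k)
      then have "\<gamma> k s \<in> U"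
        using elim(2,3) by (cases "k < N") (auto simp: q)
      then show ?thesis using arc[OF s] by (simp add: q 2)
    qed
  qed
  then show "\<forall>\<^sub>F q in at p within D_space. f q \<in> U"
    by (simp add: F_def)
qed

lemma lambda_in_paths_from: "lambda (Suc k) \<in> paths_from D_space d0"
  using lambda_path by (simp add: paths_from_def)

lemma lambda_inf_in_paths_from: "lambda_inf \<in> paths_from D_space d0"
  using lambda_inf_path by (simp add: paths_from_def)

lemma lambda_tendsto_lambda_inf:
  assumes f: "continuous_on D_space f" "f ` D_space \<subseteq> X"
    and K: "compact K" "K \<subseteq> {0..1}" and U: "openin (top_of_set X) U" "(f \<circ> lambda_inf) ` K \<subseteq> U"
  shows "\<forall>\<^sub>F k in sequentially. (f \<circ> lambda (Suc k)) ` K \<subseteq> U"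
proof -
  have "openin (top_of_set D_space) (D_space \<inter> f -` U)"
    using f U(1) by (intro continuous_openin_preimage) auto
  then obtain V where V: "open V" "D_space \<inter> f -` U = D_space \<inter> V"
    by (auto simp: openin_open)
  have "continuous_on K lambda_inf"
    using lambda_inf_path(1) K(2) by (auto simp: path_def intro: continuous_on_subset)
  then have "compact (lambda_inf ` K)"
    using K(1) by (rule compact_continuous_image)
  moreover have "lambda_inf ` K \<subseteq> V"
  proof -
    have "lambda_inf ` K \<subseteq> D_space \<inter> f -` U"
      using lambda_inf_path(2) K(2) U(2) by (auto simp: path_image_def)
    with V(2) show ?thesis by blast
  qed
  ultimately obtain e where e: "e > 0" "(\<Union>x\<in>lambda_inf ` K. ball x e) \<subseteq> V"
    using compact_subset_open_imp_ball_epsilon_subset V(1) by blast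
  have "(\<lambda>k. (1/2::real)^k) \<longlonglongrightarrow> 0"
    by (intro LIMSEQ_power_zero) simp
  then have "\<forall>\<^sub>F k in sequentially. (1/2)^k < e"
    using e(1) by (rule order_tendstoD(2))
  then show ?thesis
  proof eventually_elim
    case (elim k)
    show ?case
    proof
      fix z assume "z \<in> (f \<circ> lambda (Suc k)) ` K"
      then obtain t where t: "t \<in> K" "z = f (lambda (Suc k) t)" by auto
      then have "t \<in> {0..1}"
        using K(2) by blast
      then have "dist (lambda_inf t) (lambda (Suc k) t) = arc_height k t"
        using arc_height_nonneg[of k t] by (simp add: lambda_eq_arc_height lambda_inf_def dist_prod_def dist_real_def)
      also have "\<dots> < e"
        using arc_height_le[of k t] elim by (simp add: power_one_over)
      finally have "lambda (Suc k) t \<in> ball (lambda_inf t) e"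
        by simp
      then have "lambda (Suc k) t \<in> V"
        using e(2) t(1) by blast
      moreover have "lambda (Suc k) t \<in> D_space"
        using lambda_path(2)[of k] \<open>t \<in> {0..1}\<close> by (auto simp: path_image_def)
      ultimately show "z \<in> U"
        using V(2) t(2) by blast
    qed
  qed
qed

section \<open>The path space\<close>

definition unit_paths :: "'a::topological_space set \<Rightarrow> (real \<Rightarrow> 'a) set" where
  "unit_paths X = {p \<in> extensional {0..1}. path p \<and> path_image p \<subseteq> X}"

definition dyadic_tube :: "'a::topological_space set \<Rightarrow> nat \<Rightarrow> (nat \<Rightarrow> 'a set) \<Rightarrow> (real \<Rightarrow> 'a) set" where
  "dyadic_tube X k U = {p \<in> unit_paths X. \<forall>j\<in>{1..2^k}. p ` dyadic_interval k j \<subseteq> U j}"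

lemma path_space_eq:
  "path_space X = topology_generated_by
     {{p \<in> unit_paths X. p ` K \<subseteq> U} | K U. compact K \<and> K \<subseteq> {0..1} \<and> openin (top_of_set X) U}"
  by (simp add: path_space_def unit_paths_def Let_def)

lemma openin_path_space_subbasic:
  assumes "compact K" "K \<subseteq> {0..1}" "openin (top_of_set X) U"
  shows "openin (path_space X) {p \<in> unit_paths X. p ` K \<subseteq> U}"
  unfolding path_space_eq using assms by (intro topology_generated_by_Basis) blast

lemma topspace_path_space: "topspace (path_space X) = unit_paths X"
proof
  show "topspace (path_space X) \<subseteq> unit_paths X"
    unfolding path_space_eq by auto
  show "unit_paths X \<subseteq> topspace (path_space X)"
    using openin_subset[OF openin_path_space_subbasic[of "{}" X X]] by auto
qed

lemma restrict_in_unit_paths: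
  assumes "path p" "path_image p \<subseteq> X"
  shows "restrict p {0..1} \<in> unit_paths X"
proof -
  have "continuous_on {0..1} (restrict p {0..1})"
    using assms(1)[unfolded path_def] by (rule continuous_on_eq) simp
  then show ?thesis
    using assms(2) by (auto simp: unit_paths_def path_def path_image_def)
qed

lemma openin_dyadic_tube:
  assumes "\<And>j. j \<in> {1..2^k} \<Longrightarrow> openin (top_of_set X) (U j)"
  shows "openin (path_space X) (dyadic_tube X k U)"
proof -
  have "openin (path_space X)
          (\<Inter>j\<in>{1..2^k}. {p \<in> unit_paths X. p ` dyadic_interval k j \<subseteq> U j})"
  proof (rule openin_INT2)
    fix j :: nat assume j: "j \<in> {1..2^k}"
    show "openin (path_space X) {p \<in> unit_paths X. p ` dyadic_interval k j \<subseteq> U j}"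
      using dyadic_interval_subset_unit[OF j] assms[OF j]
      by (intro openin_path_space_subbasic) (auto simp: dyadic_interval_def)
  qed auto
  moreover have "(\<Inter>j\<in>{1..2^k}. {p \<in> unit_paths X. p ` dyadic_interval k j \<subseteq> U j})
      = dyadic_tube X k U"
  proof -
    have "(1::nat) \<in> {1..2^k}"
      by simp
    then show ?thesis
      unfolding dyadic_tube_def by blast
  qed
  ultimately show ?thesis by simp
qed

text \<open>
  A Lebesgue number: by compactness the neighbourhoods of the points of \<open>K\<close> that \<open>\<alpha>\<close> keeps in \<open>U\<close>
  can be chosen of one size.
\<close>
lemma path_near_compact:
  assumes "path \<alpha>" "path_image \<alpha> \<subseteq> X" "compact K" "K \<subseteq> {0..1}" "openin (top_of_set X) U" "\<alpha> ` K \<subseteq> U"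
  obtains e where "e > 0" "\<And>s t. s \<in> K \<Longrightarrow> t \<in> {0..1} \<Longrightarrow> dist s t < e \<Longrightarrow> \<alpha> t \<in> U"
proof -
  have "continuous_on {0..1} \<alpha>" "\<alpha> \<in> {0..1} \<rightarrow> X"
    using assms(1,2) by (auto simp: path_def path_image_def)
  then have "openin (top_of_set {0..1}) ({0..1} \<inter> \<alpha> -` U)"
    using assms(5) by (rule continuous_openin_preimage)
  then obtain V where V: "open V" "{0..1} \<inter> \<alpha> -` U = {0..1} \<inter> V"
    by (auto simp: openin_open)
  have "K \<subseteq> V"
    using V(2) assms(4,6) by blast
  then obtain e where e: "e > 0" "(\<Union>x\<in>K. ball x e) \<subseteq> V"
    using compact_subset_open_imp_ball_epsilon_subset[OF assms(3) V(1)] by blast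
  have "\<alpha> t \<in> U" if "s \<in> K" "t \<in> {0..1}" "dist s t < e" for s t
  proof -
    have "t \<in> ball s e"
      using that(3) by simp
    then have "t \<in> V"
      using e(2) that(1) by blast
    with V(2) that(2) show ?thesis by blast
  qed
  with e(1) show ?thesis by (rule that)
qed

text \<open>
  For a subbasic set given by \<open>K\<close> and \<open>U\<close>, take the level so high that \<open>\<alpha>\<close> maps every dyadic
  interval that meets \<open>K\<close> into \<open>U\<close>, and leave the other intervals unconstrained. Asking for all
  high levels, not just one, makes the property pass to intersections, and it allows to
  force agreement with \<open>\<alpha>\<close> at arbitrarily fine dyadic points.
\<close>
lemma dyadic_tubes_form_base:
  assumes "openin (path_space X) W" "\<alpha> \<in> W"
  shows "\<exists>k0. \<forall>k\<ge>k0. \<exists>U. (\<forall>j\<in>{1..2^k}. openin (top_of_set X) (U j)) \<and>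
           \<alpha> \<in> dyadic_tube X k U \<and> dyadic_tube X k U \<subseteq> W"
proof -
  define \<S> where "\<S> = {{p \<in> unit_paths X. p ` K \<subseteq> U} | K U.
    compact K \<and> K \<subseteq> {0..1} \<and> openin (top_of_set X) U}"
  have "generate_topology_on \<S> W"
    using assms(1) by (intro openin_topology_generated_by) (simp only: path_space_eq \<S>_def)
  then show ?thesis
    using assms(2)
  proof (induction W rule: generate_topology_on.induct)
    case Empty
    then show ?case by simp
  next
    case (Int A B)
    then obtain a b where
      a: "\<And>k. k \<ge> a \<Longrightarrow> \<exists>U. (\<forall>j\<in>{1..2^k}. openin (top_of_set X) (U j)) \<and>
             \<alpha> \<in> dyadic_tube X k U \<and> dyadic_tube X k U \<subseteq> A" and
      b: "\<And>k. k \<ge> b \<Longrightarrow> \<exists>U. (\<forall>j\<in>{1..2^k}. openin (top_of_set X) (U j)) \<and>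
             \<alpha> \<in> dyadic_tube X k U \<and> dyadic_tube X k U \<subseteq> B"
      by (metis IntE)
    show ?case
    proof (intro exI[of _ "max a b"] allI impI)
      fix k assume "max a b \<le> k"
      then obtain U V where
        U: "\<forall>j\<in>{1..2^k}. openin (top_of_set X) (U j)" "\<alpha> \<in> dyadic_tube X k U" "dyadic_tube X k U \<subseteq> A" and
        V: "\<forall>j\<in>{1..2^k}. openin (top_of_set X) (V j)" "\<alpha> \<in> dyadic_tube X k V" "dyadic_tube X k V \<subseteq> B"
        using a[of k] b[of k] by auto
      have "dyadic_tube X k (\<lambda>j. U j \<inter> V j) = dyadic_tube X k U \<inter> dyadic_tube X k V"
        unfolding dyadic_tube_def by blast
      with U V show "\<exists>U. (\<forall>j\<in>{1..2^k}. openin (top_of_set X) (U j)) \<and>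
             \<alpha> \<in> dyadic_tube X k U \<and> dyadic_tube X k U \<subseteq> A \<inter> B"
        by (intro exI[of _ "\<lambda>j. U j \<inter> V j"]) (auto intro: openin_Int)
    qed
  next
    case (UN \<K>)
    then obtain A where A: "A \<in> \<K>" "\<alpha> \<in> A" by blast
    then obtain a where
      "\<And>k. k \<ge> a \<Longrightarrow> \<exists>U. (\<forall>j\<in>{1..2^k}. openin (top_of_set X) (U j)) \<and>
             \<alpha> \<in> dyadic_tube X k U \<and> dyadic_tube X k U \<subseteq> A"
      using UN.IH by meson
    with A(1) show ?case
      by (meson Union_upper subset_trans)
  next
    case (Basis s)
    then obtain K U where s: "s = {p \<in> unit_paths X. p ` K \<subseteq> U}"
      and K: "compact K" "K \<subseteq> {0..1}" and U: "openin (top_of_set X) U"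
      unfolding \<S>_def by blast
    have \<alpha>: "\<alpha> \<in> unit_paths X" "\<alpha> ` K \<subseteq> U"
      using Basis s by auto
    then obtain e where e: "e > 0" "\<And>s t. s \<in> K \<Longrightarrow> t \<in> {0..1} \<Longrightarrow> dist s t < e \<Longrightarrow> \<alpha> t \<in> U"
      using path_near_compact[OF _ _ K U] unfolding unit_paths_def by blast
    obtain k0 :: nat where k0: "(1/2)^k0 < e"
      using real_arch_pow_inv[of e "1/2"] e(1) by auto
    show ?case
    proof (intro exI[of _ k0] allI impI)
      fix k assume "k0 \<le> k"
      then have "(1/2)^k \<le> (1/2::real)^k0"
        by (intro power_decreasing) auto
      with k0 have k: "1 / 2^k < e"
        by (simp add: power_one_over)
      define V where "V j = (if dyadic_interval k j \<inter> K = {} then X else U)" for j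
      have "\<alpha> ` dyadic_interval k j \<subseteq> V j" if j: "j \<in> {1..2^k}" for j
      proof (cases "dyadic_interval k j \<inter> K = {}")
        case True
        then show ?thesis
          using \<alpha>(1) dyadic_interval_subset_unit[OF j]
          by (auto simp: V_def unit_paths_def path_image_def)
      next
        case False
        then obtain s where s: "s \<in> dyadic_interval k j" "s \<in> K" by blast
        have "\<alpha> t \<in> U" if t: "t \<in> dyadic_interval k j" for t
        proof (rule e(2)[OF s(2)])
          show "t \<in> {0..1}"
            using t dyadic_interval_subset_unit[OF j] by blast
          have "\<bar>s - t\<bar> \<le> real j / 2^k - (real j - 1) / 2^k"
            using s(1) t unfolding dyadic_interval_def atLeastAtMost_iff by linarith
          also have "\<dots> = 1 / 2^k"
            by (simp add: diff_divide_distrib)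
          finally show "dist s t < e"
            using k by (simp add: dist_real_def)
        qed
        with False show ?thesis by (auto simp: V_def)
      qed
      then have "\<alpha> \<in> dyadic_tube X k V"
        using \<alpha>(1) by (simp add: dyadic_tube_def)
      moreover have "dyadic_tube X k V \<subseteq> s"
      proof
        fix p assume p: "p \<in> dyadic_tube X k V"
        have "p t \<in> U" if t: "t \<in> K" for t
        proof -
          obtain j where "j \<in> {1..2^k}" "t \<in> dyadic_interval k j"
            using t K(2) unit_interval_dyadic_cover[of t k] by blast
          with p t have "p t \<in> V j" "dyadic_interval k j \<inter> K \<noteq> {}"
            unfolding dyadic_tube_def by blast+
          then show ?thesis by (simp add: V_def)
        qed
        with p show "p \<in> s"
          by (auto simp: s dyadic_tube_def)
      qed
      moreover have "openin (top_of_set X) (V j)" for j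
        using U by (simp add: V_def)
      ultimately show "\<exists>U. (\<forall>j\<in>{1..2^k}. openin (top_of_set X) (U j)) \<and>
             \<alpha> \<in> dyadic_tube X k U \<and> dyadic_tube X k U \<subseteq> s"
        by blast
    qed
  qed
qed

lemma (in Metric_space) compactin_metric_neighbourhood:
  assumes "compactin mtopology C" "openin mtopology U" "C \<subseteq> U"
  shows "\<exists>e>0. (\<Union>x\<in>C. mball x e) \<subseteq> U"
  using lebesgue_number[OF assms(1), of "{U}"] assms(2,3) by auto

text \<open>
  A countable base at \<open>\<alpha>\<close> is given by the tubes, of any level, built from the neighbourhoods of
  radius \<open>1/(m + 1)\<close> of the pieces of \<open>\<alpha>\<close>. The pieces are compact, so a small enough radius fits
  into any given tube.
\<close>
lemma first_countable_path_space:
  assumes "metrizable_space (top_of_set X)"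
  shows "first_countable (path_space X)"
proof -
  obtain M d where "Metric_space M d" and top: "top_of_set X = Metric_space.mtopology M d"
    using assms unfolding metrizable_space_def by blast
  then interpret Metric_space M d by simp
  define N where "N A m = (\<Union>a\<in>A. mball a (1 / Suc m))" for A m
  show ?thesis
    unfolding first_countable_def topspace_path_space
  proof
    fix \<alpha> assume \<alpha>: "\<alpha> \<in> unit_paths X"
    define \<B> where "\<B> = range (\<lambda>(k, m). dyadic_tube X k (\<lambda>j. N (\<alpha> ` dyadic_interval k j) m))"
    have "openin (path_space X) V" if "V \<in> \<B>" for V
      using that unfolding \<B>_def N_def by (auto simp: top intro!: openin_dyadic_tube)
    moreover have "\<exists>V\<in>\<B>. \<alpha> \<in> V \<and> V \<subseteq> W" if "openin (path_space X) W" "\<alpha> \<in> W" for W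
    proof -
      obtain k U where U: "\<forall>j\<in>{1..2^k}. openin (top_of_set X) (U j)"
        "\<alpha> \<in> dyadic_tube X k U" "dyadic_tube X k U \<subseteq> W"
        using dyadic_tubes_form_base[OF \<open>openin (path_space X) W\<close> \<open>\<alpha> \<in> W\<close>] by blast
      have sub: "\<alpha> ` dyadic_interval k j \<subseteq> X" if "j \<in> {1..2^k}" for j
        using \<alpha> dyadic_interval_subset_unit[OF that] by (auto simp: unit_paths_def path_image_def)
      have "\<forall>\<^sub>F m in sequentially. N (\<alpha> ` dyadic_interval k j) m \<subseteq> U j" if j: "j \<in> {1..2^k}" for j
      proof -
        have "continuous_on (dyadic_interval k j) \<alpha>"
          using \<alpha> dyadic_interval_subset_unit[OF j]
          by (auto simp: unit_paths_def path_def intro: continuous_on_subset)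
        then have "compact (\<alpha> ` dyadic_interval k j)"
          by (rule compact_continuous_image) (simp add: dyadic_interval_def)
        then have "compactin mtopology (\<alpha> ` dyadic_interval k j)"
          using sub[OF j] by (simp add: top[symmetric] compactin_subtopology)
        then obtain e where e: "e > 0" "(\<Union>x\<in>\<alpha> ` dyadic_interval k j. mball x e) \<subseteq> U j"
          using compactin_metric_neighbourhood[of "\<alpha> ` dyadic_interval k j" "U j"] U(1,2) j
          by (auto simp: top dyadic_tube_def)
        have "\<forall>\<^sub>F m in sequentially. 1 / real (Suc m) < e"
          using order_tendstoD(2)[OF LIMSEQ_inverse_real_of_nat e(1)] by (simp add: inverse_eq_divide)
        then show ?thesis
        proof eventually_elim
          case (elim m)
          then have "N (\<alpha> ` dyadic_interval k j) m \<subseteq> (\<Union>x\<in>\<alpha> ` dyadic_interval k j. mball x e)"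
            unfolding N_def by (intro UN_mono mball_subset_concentric) auto
          with e(2) show ?case by (rule subset_trans[rotated])
        qed
      qed
      then have "\<forall>\<^sub>F m in sequentially. \<forall>j\<in>{1..2^k}. N (\<alpha> ` dyadic_interval k j) m \<subseteq> U j"
        by (intro eventually_ball_finite) auto
      then obtain m where m: "\<And>j. j \<in> {1..2^k} \<Longrightarrow> N (\<alpha> ` dyadic_interval k j) m \<subseteq> U j"
        using eventually_happens'[OF sequentially_bot] by blast
      have "M = X"
        using arg_cong[OF top, of topspace] by simp
      have "\<alpha> ` dyadic_interval k j \<subseteq> N (\<alpha> ` dyadic_interval k j) m" if "j \<in> {1..2^k}" for j
      proof
        fix x assume x: "x \<in> \<alpha> ` dyadic_interval k j"
        then have "x \<in> M"
          using sub[OF that] \<open>M = X\<close> by blast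
        then have "x \<in> mball x (1 / Suc m)"
          by simp
        with x show "x \<in> N (\<alpha> ` dyadic_interval k j) m"
          unfolding N_def by blast
      qed
      then have "\<alpha> \<in> dyadic_tube X k (\<lambda>j. N (\<alpha> ` dyadic_interval k j) m)"
        using \<alpha> by (simp add: dyadic_tube_def)
      moreover have "dyadic_tube X k (\<lambda>j. N (\<alpha> ` dyadic_interval k j) m) \<subseteq> W"
        using m U(3) unfolding dyadic_tube_def by blast
      ultimately show ?thesis
        unfolding \<B>_def by blast
    qed
    moreover have "countable \<B>"
      by (simp add: \<B>_def)
    ultimately show "\<exists>\<B>. countable \<B> \<and> (\<forall>V\<in>\<B>. openin (path_space X) V) \<and>
        (\<forall>U. openin (path_space X) U \<and> \<alpha> \<in> U \<longrightarrow> (\<exists>V\<in>\<B>. \<alpha> \<in> V \<and> V \<subseteq> U))"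
      by blast
  qed
qed

lemma first_countable_decreasing_base:
  assumes "first_countable T" "x \<in> topspace T"
  obtains W :: "nat \<Rightarrow> 'a set" where "\<And>n. openin T (W n)" "\<And>n. x \<in> W n"
    "\<And>U. openin T U \<Longrightarrow> x \<in> U \<Longrightarrow> \<forall>\<^sub>F n in sequentially. W n \<subseteq> U"
proof -
  obtain \<B> where \<B>: "countable \<B>" "\<And>V. V \<in> \<B> \<Longrightarrow> openin T V"
    "\<And>U. openin T U \<Longrightarrow> x \<in> U \<Longrightarrow> \<exists>V\<in>\<B>. x \<in> V \<and> V \<subseteq> U"
    using assms unfolding first_countable_def by metis
  define \<C> where "\<C> = {V \<in> \<B>. x \<in> V}"
  have \<C>: "countable \<C>" "\<C> \<noteq> {}"
    using \<B>(1) \<B>(3)[OF openin_topspace assms(2)] by (auto simp: \<C>_def)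
  define W where "W n = \<Inter> (from_nat_into \<C> ` {..n})" for n
  have C: "from_nat_into \<C> n \<in> \<C>" for n
    using \<C>(2) by (rule from_nat_into)
  show ?thesis
  proof (rule that[of W])
    show "openin T (W n)" for n
      unfolding W_def using C \<B>(2) by (intro openin_Inter) (auto simp: \<C>_def)
    show "x \<in> W n" for n
      using C by (auto simp: W_def \<C>_def)
    fix U assume "openin T U" "x \<in> U"
    then obtain V where V: "V \<in> \<C>" "V \<subseteq> U"
      using \<B>(3) by (auto simp: \<C>_def)
    then obtain N where N: "V = from_nat_into \<C> N"
      using from_nat_into_surj[OF \<C>(1)] by metis
    have "W n \<subseteq> U" if "n \<ge> N" for n
      using that V(2) unfolding W_def N by blast
    then show "\<forall>\<^sub>F n in sequentially. W n \<subseteq> U"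
      unfolding eventually_sequentially by blast
  qed
qed

section \<open>The two implications\<close>

text \<open>
  Numbering the levels from \<open>0\<close> matches the dyadic intervals with those of \<open>lambda (Suc k)\<close> and
  removes the exponent \<open>n - 1\<close>.
\<close>
lemma homotopically_path_Hausdorff_rel_iff:
  "homotopically_path_Hausdorff_rel X x0 H \<longleftrightarrow>
    (\<forall>\<alpha> \<in> paths_from X x0. \<forall>\<beta> \<in> paths_from X x0.
       pathfinish \<alpha> = pathfinish \<beta> \<and> \<not> congruent_paths X H \<alpha> \<beta> \<longrightarrow>
       (\<exists>k U. (\<forall>j\<in>{1..2^k}. openin (top_of_set X) (U j) \<and> \<alpha> ` dyadic_interval k j \<subseteq> U j) \<and>
          (\<forall>\<gamma>. path \<gamma> \<and> path_image \<gamma> \<subseteq> X \<and> (\<forall>j\<in>{1..2^k}. \<gamma> ` dyadic_interval k j \<subseteq> U j) \<and>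
             (\<forall>j\<in>{0..2^k}. \<gamma> (real j / 2^k) = \<alpha> (real j / 2^k)) \<longrightarrow>
             \<not> congruent_paths X H \<gamma> \<beta>)))"
proof -
  define witness where "witness \<alpha> \<beta> k \<longleftrightarrow> (\<exists>U.
      (\<forall>j\<in>{1..2^k}. openin (top_of_set X) (U j) \<and> \<alpha> ` dyadic_interval k j \<subseteq> U j) \<and>
      (\<forall>\<gamma>. path \<gamma> \<and> path_image \<gamma> \<subseteq> X \<and> (\<forall>j\<in>{1..2^k}. \<gamma> ` dyadic_interval k j \<subseteq> U j) \<and>
         (\<forall>j\<in>{0..2^k}. \<gamma> (real j / 2^k) = \<alpha> (real j / 2^k)) \<longrightarrow>
         \<not> congruent_paths X H \<gamma> \<beta>))" for \<alpha> \<beta> k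
  have shift: "(\<exists>n\<ge>1. witness \<alpha> \<beta> (n - 1)) \<longleftrightarrow> (\<exists>k. witness \<alpha> \<beta> k)" for \<alpha> \<beta>
    by (metis One_nat_def diff_Suc_1 le_add1 plus_1_eq_Suc)
  have "homotopically_path_Hausdorff_rel X x0 H \<longleftrightarrow>
    (\<forall>\<alpha> \<in> paths_from X x0. \<forall>\<beta> \<in> paths_from X x0.
       pathfinish \<alpha> = pathfinish \<beta> \<and> \<not> congruent_paths X H \<alpha> \<beta> \<longrightarrow> (\<exists>n\<ge>1. witness \<alpha> \<beta> (n - 1)))"
    unfolding homotopically_path_Hausdorff_rel_def witness_def congruent_paths_def
      dyadic_interval_def by (rule refl)
  then show ?thesis
    unfolding shift unfolding witness_def .
qed

text \<open>
  The paths \<open>f \<circ> lambda (Suc k)\<close> are all congruent and converge to \<open>f \<circ> lambda_inf\<close>,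
  with which they agree at all dyadic points of level \<open>k\<close>. So they
  eventually enter any neighbourhood of \<open>f \<circ> lambda_inf\<close> supplied by the Hausdorff property.
\<close>
lemma closed_if_homotopically_path_Hausdorff:
  assumes H: "subgroup H (fundamental_group X x0)"
    and Haus: "homotopically_path_Hausdorff_rel X x0 H"
  shows "pi1_closed D_space d0 S_group d_inf X x0 H"
  unfolding pi1_closed_def
proof (intro allI impI)
  fix f :: "real \<times> real \<Rightarrow> 'a"
  assume "continuous_on D_space f \<and> f ` D_space \<subseteq> X \<and> f d0 = x0 \<and> induced_hom X f ` S_group \<subseteq> H"
  then have f: "continuous_on D_space f" "f ` D_space \<subseteq> X" "f d0 = x0"
    and S: "induced_hom X f ` S_group \<subseteq> H" by auto
  let ?l = "\<lambda>k. f \<circ> lambda (Suc k)" and ?b = "f \<circ> lambda_inf"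
  have l: "?l k \<in> paths_from X x0" for k
    using f lambda_in_paths_from by (rule compose_in_paths_from)
  have b: "?b \<in> paths_from X x0"
    using f lambda_inf_in_paths_from by (rule compose_in_paths_from)
  have ends: "pathfinish (?l k) = f (1, 0)" "pathfinish ?b = f (1, 0)" for k
    by (simp_all add: pathfinish_compose lambda_path lambda_inf_path)
  have step: "congruent_paths X H (?l k) (?l (Suc k))" for k
  proof -
    have "s_elt (Suc k) \<in> S_group"
      unfolding S_group_def by (rule generate.incl) auto
    then have "induced_hom X f (s_elt (Suc k)) \<in> H"
      using S by blast
    then show ?thesis
      unfolding s_elt_def
      by (simp add: induced_hom_mem_iff_congruent[OF f(1,2) lambda_in_paths_from lambda_in_paths_from] lambda_path)
  qed
  have chain: "congruent_paths X H (?l 0) (?l k)" for k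
  proof (induction k)
    case 0
    show ?case using H l by (rule congruent_paths_refl)
  next
    case (Suc k)
    show ?case
      by (rule congruent_paths_trans[OF H l l l _ _ Suc.IH step]) (simp_all only: ends)
  qed
  have "congruent_paths X H ?b (?l 0)"
  proof (rule ccontr)
    assume "\<not> congruent_paths X H ?b (?l 0)"
    then obtain k0 U where
      U: "\<And>j. j \<in> {1..2^k0} \<Longrightarrow> openin (top_of_set X) (U j) \<and> ?b ` dyadic_interval k0 j \<subseteq> U j" and
      avoid: "\<And>\<gamma>. path \<gamma> \<Longrightarrow> path_image \<gamma> \<subseteq> X \<Longrightarrow>
        (\<forall>j\<in>{1..2^k0}. \<gamma> ` dyadic_interval k0 j \<subseteq> U j) \<Longrightarrow>
        (\<forall>j\<in>{0..2^k0}. \<gamma> (real j / 2^k0) = ?b (real j / 2^k0)) \<Longrightarrow> \<not> congruent_paths X H \<gamma> (?l 0)"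
      using Haus[unfolded homotopically_path_Hausdorff_rel_iff, rule_format, OF b l[of 0]] ends by metis
    have "\<forall>\<^sub>F k in sequentially. \<forall>j\<in>{1..2^k0}. ?l k ` dyadic_interval k0 j \<subseteq> U j"
    proof (rule eventually_ball_finite)
      show "\<forall>j\<in>{1..2^k0}. \<forall>\<^sub>F k in sequentially. ?l k ` dyadic_interval k0 j \<subseteq> U j"
      proof
        fix j :: nat assume j: "j \<in> {1..2^k0}"
        have "compact (dyadic_interval k0 j)"
          by (simp add: dyadic_interval_def)
        with U[OF j] dyadic_interval_subset_unit[OF j]
        show "\<forall>\<^sub>F k in sequentially. ?l k ` dyadic_interval k0 j \<subseteq> U j"
          by (intro lambda_tendsto_lambda_inf[OF f(1,2)]) auto
      qed
    qed simp
    then have "\<forall>\<^sub>F k in sequentially. k \<ge> k0 \<and> (\<forall>j\<in>{1..2^k0}. ?l k ` dyadic_interval k0 j \<subseteq> U j)"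
      using eventually_ge_at_top by (rule eventually_conj[rotated])
    then obtain k where k: "k \<ge> k0" "\<forall>j\<in>{1..2^k0}. ?l k ` dyadic_interval k0 j \<subseteq> U j"
      using eventually_happens'[OF sequentially_bot] by blast
    have "?l k (real j / 2^k0) = ?b (real j / 2^k0)" if "j \<in> {0..2^k0}" for j
    proof -
      have "real j \<le> 2^k0"
        using that by (metis atLeastAtMost_iff of_nat_le_iff of_nat_numeral of_nat_power)
      then have "real j / 2^k0 \<in> {0..1}"
        by simp
      then show ?thesis
        using arc_height_dyadic_point[OF k(1)] by (simp add: lambda_eq_arc_height lambda_inf_def)
    qed
    then have "\<not> congruent_paths X H (?l k) (?l 0)"
      using l[of k] k(2) by (intro avoid) (auto simp: paths_from_def)
    moreover have "congruent_paths X H (?l k) (?l 0)"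
      by (rule congruent_paths_sym[OF H l l _ chain]) (simp only: ends)
    ultimately show False by simp
  qed
  then have "congruent_paths X H (?l 0) ?b"
    by (rule congruent_paths_sym[OF H b l, rotated]) (simp only: ends)
  then show "induced_hom X f d_inf \<in> H"
    unfolding d_inf_def
    by (simp add: induced_hom_mem_iff_congruent[OF f(1,2) lambda_in_paths_from lambda_inf_in_paths_from, of 0, simplified]
        lambda_path(4)[of 0, simplified] lambda_inf_path)
qed
text \<open>
  If the property fails for \<open>\<alpha>\<close> and \<open>\<beta>\<close>, then paths congruent to \<open>\<beta>\<close> accumulate at \<open>\<alpha>\<close>. First
  countability extracts a sequence \<open>\<gamma> k\<close> of them, which is glued along \<open>\<alpha>\<close> to a map \<open>f\<close>
  of the test space with \<open>f \<circ> lambda (Suc k) = \<gamma> k\<close>. Closedness of \<open>H\<close> makes \<open>\<alpha>\<close> congruent to \<open>\<gamma> 0\<close>,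
  hence to \<open>\<beta>\<close>.
\<close>
lemma homotopically_path_Hausdorff_if_closed:
  assumes H: "subgroup H (fundamental_group X x0)" and "x0 \<in> X"
    and fc: "first_countable (path_space X)"
    and closed: "pi1_closed D_space d0 S_group d_inf X x0 H"
  shows "homotopically_path_Hausdorff_rel X x0 H"
  unfolding homotopically_path_Hausdorff_rel_iff
proof (intro ballI impI, rule ccontr)
  fix \<alpha> \<beta>
  assume \<alpha>: "\<alpha> \<in> paths_from X x0" and \<beta>: "\<beta> \<in> paths_from X x0"
    and "pathfinish \<alpha> = pathfinish \<beta> \<and> \<not> congruent_paths X H \<alpha> \<beta>"
    and none: "\<nexists>k U. (\<forall>j\<in>{1..2^k}. openin (top_of_set X) (U j) \<and> \<alpha> ` dyadic_interval k j \<subseteq> U j) \<and>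
       (\<forall>\<gamma>. path \<gamma> \<and> path_image \<gamma> \<subseteq> X \<and> (\<forall>j\<in>{1..2^k}. \<gamma> ` dyadic_interval k j \<subseteq> U j) \<and>
          (\<forall>j\<in>{0..2^k}. \<gamma> (real j / 2^k) = \<alpha> (real j / 2^k)) \<longrightarrow> \<not> congruent_paths X H \<gamma> \<beta>)"
  then have end_\<beta>: "pathfinish \<alpha> = pathfinish \<beta>" and not_congruent: "\<not> congruent_paths X H \<alpha> \<beta>"
    by auto
  have bad: "\<exists>\<gamma>. path \<gamma> \<and> path_image \<gamma> \<subseteq> X \<and> (\<forall>j\<in>{1..2^k}. \<gamma> ` dyadic_interval k j \<subseteq> U j) \<and>
         (\<forall>j\<in>{0..2^k}. \<gamma> (real j / 2^k) = \<alpha> (real j / 2^k)) \<and> congruent_paths X H \<gamma> \<beta>"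
    if "\<forall>j\<in>{1..2^k}. openin (top_of_set X) (U j) \<and> \<alpha> ` dyadic_interval k j \<subseteq> U j" for k U
    using none[unfolded not_ex, THEN spec, THEN spec, of k U] that by blast
  have path_\<alpha>: "path \<alpha>" "path_image \<alpha> \<subseteq> X" "pathstart \<alpha> = x0"
    using \<alpha> by (auto simp: paths_from_def)
  let ?r = "\<lambda>p::real \<Rightarrow> 'a. restrict p {0..1}"
  obtain W where W: "\<And>n. openin (path_space X) (W n)" "\<And>n. ?r \<alpha> \<in> W n"
    "\<And>V. openin (path_space X) V \<Longrightarrow> ?r \<alpha> \<in> V \<Longrightarrow> \<forall>\<^sub>F n in sequentially. W n \<subseteq> V"
    using first_countable_decreasing_base[OF fc,
        unfolded topspace_path_space, OF restrict_in_unit_paths[OF path_\<alpha>(1,2)]] by blast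
  have "\<exists>\<gamma>. path \<gamma> \<and> path_image \<gamma> \<subseteq> X \<and> ?r \<gamma> \<in> W k \<and>
      (\<forall>j\<in>{0..2^k}. \<gamma> (real j / 2^k) = \<alpha> (real j / 2^k)) \<and> congruent_paths X H \<gamma> \<beta>" for k
  proof -
    obtain k0 where k0: "\<And>l. l \<ge> k0 \<Longrightarrow> \<exists>U. (\<forall>j\<in>{1..2^l}. openin (top_of_set X) (U j)) \<and>
           ?r \<alpha> \<in> dyadic_tube X l U \<and> dyadic_tube X l U \<subseteq> W k"
      using dyadic_tubes_form_base[OF W(1,2)] by blast
    \<comment> \<open>a level above \<open>k\<close>, so that agreement with \<open>\<alpha>\<close> at level \<open>l\<close> includes agreement at level \<open>k\<close>\<close>
    define l where "l = max k k0"
    then have l: "l \<ge> k" "l \<ge> k0" by auto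
    obtain U where U: "\<forall>j\<in>{1..2^l}. openin (top_of_set X) (U j)"
      "?r \<alpha> \<in> dyadic_tube X l U" "dyadic_tube X l U \<subseteq> W k"
      using k0[OF l(2)] by blast
    have restr: "?r p ` dyadic_interval l j = p ` dyadic_interval l j" if "j \<in> {1..2^l}" for p :: "real \<Rightarrow> 'a" and j
      using dyadic_interval_subset_unit[OF that] by (intro image_cong) auto
    have "\<forall>j\<in>{1..2^l}. openin (top_of_set X) (U j) \<and> \<alpha> ` dyadic_interval l j \<subseteq> U j"
      using U(1,2) restr[of _ \<alpha>] unfolding dyadic_tube_def by blast
    from bad[OF this] obtain \<gamma> where \<gamma>: "path \<gamma>" "path_image \<gamma> \<subseteq> X" "\<forall>j\<in>{1..2^l}. \<gamma> ` dyadic_interval l j \<subseteq> U j"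
      "\<forall>j\<in>{0..2^l}. \<gamma> (real j / 2^l) = \<alpha> (real j / 2^l)" "congruent_paths X H \<gamma> \<beta>"
      by blast
    have "?r \<gamma> \<in> dyadic_tube X l U"
      using restrict_in_unit_paths[OF \<gamma>(1,2)] \<gamma>(3) restr[of _ \<gamma>] unfolding dyadic_tube_def by blast
    moreover have "\<gamma> (real j / 2^k) = \<alpha> (real j / 2^k)" if "j \<in> {0..2^k}" for j
    proof -
      define m where "m = 2^(l - k) * j"
      have "2^(l - k) * 2^k = (2::nat)^l"
        using l(1) by (simp flip: power_add)
      moreover have "m \<le> 2^(l - k) * 2^k"
        using that by (simp add: m_def)
      ultimately have "m \<in> {0..2^l}"
        by simp
      moreover have "2^(l - k) * 2^k = (2::real)^l"
        using l(1) by (simp flip: power_add)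
      then have "real m / 2^l = real j / 2^k"
        by (simp add: m_def flip: \<open>2^(l - k) * 2^k = (2::real)^l\<close>)
      ultimately show ?thesis
        using \<gamma>(4) by metis
    qed
    ultimately show ?thesis
      using \<gamma> U(3) by blast
  qed
  then obtain \<gamma> where path_\<gamma>: "\<And>k. path (\<gamma> k)" "\<And>k. path_image (\<gamma> k) \<subseteq> X"
    and near: "\<And>k. ?r (\<gamma> k) \<in> W k"
    and agree: "\<And>k j. j \<in> {0..2^k} \<Longrightarrow> \<gamma> k (real j / 2^k) = \<alpha> (real j / 2^k)"
    and congr: "\<And>k. congruent_paths X H (\<gamma> k) \<beta>"
    by metis
  have ends: "pathfinish (\<gamma> k) = pathfinish \<alpha>" "pathstart (\<gamma> k) = pathstart \<alpha>" for k
    using agree[of "2^k" k] agree[of 0 k] by (simp_all add: pathfinish_def pathstart_def)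
  have \<gamma>: "\<gamma> k \<in> paths_from X x0" for k
    using path_\<gamma> ends path_\<alpha>(3) by (simp add: paths_from_def)

  \<comment> \<open>off the base the level is unique, so the choice operator only names it\<close>
  define f where "f = (\<lambda>(x, y). if y = 0 then \<alpha> x else \<gamma> (SOME k. y = arc_height k x) x)"
  have f_base: "f (x, 0) = \<alpha> x" for x
    by (simp add: f_def)
  have f_arc: "f (x, arc_height k x) = \<gamma> k x" if x: "x \<in> {0..1}" for k x
  proof (cases "arc_height k x = 0")
    case True
    with x obtain j where "j \<in> {0..2^k}" "x = real j / 2^k"
      using zero_arc_height_is_dyadic by blast
    with True show ?thesis
      using agree by (simp add: f_base)
  next
    case False
    have "arc_height k x = arc_height (SOME l. arc_height k x = arc_height l x) x"
      by (rule someI[of _ k]) simp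
    moreover have "arc_height k x > 0"
      using False arc_height_nonneg[of k x] by simp
    ultimately have "k = (SOME l. arc_height k x = arc_height l x)"
      by (rule arc_height_inj)
    with False show ?thesis
      by (simp add: f_def)
  qed
  have "continuous_on D_space f"
  proof (rule continuous_on_D_space_glue[OF _ _ f_base f_arc])
    show "continuous_on {0..1} \<alpha>" "continuous_on {0..1} (\<gamma> k)" for k
      using path_\<alpha>(1) path_\<gamma>(1) by (auto simp: path_def)
    fix x U assume x: "x \<in> {0..1::real}" and U: "open U" "\<alpha> x \<in> U"
    have U': "openin (top_of_set X) (X \<inter> U)"
      using U(1) by (simp add: openin_open_Int)
    have "\<alpha> ` {x} \<subseteq> X \<inter> U"
      using U(2) x path_\<alpha>(2) by (auto simp: path_image_def)
    then obtain e where e: "e > 0" "\<And>s t. s \<in> {x} \<Longrightarrow> t \<in> {0..1} \<Longrightarrow> dist s t < e \<Longrightarrow> \<alpha> t \<in> X \<inter> U"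
      using path_near_compact[OF path_\<alpha>(1,2) compact_sing _ U'] x by blast
    \<comment> \<open>a compact neighbourhood of \<open>x\<close> that \<open>\<alpha>\<close> maps into \<open>U\<close>; almost all \<open>\<gamma> k\<close> then do the same\<close>
    define K where "K = {0..1} \<inter> cball x (e/2)"
    have K: "compact K" "K \<subseteq> {0..1}"
      unfolding K_def by (auto intro: compact_Int)
    have "?r \<alpha> \<in> {p \<in> unit_paths X. p ` K \<subseteq> X \<inter> U}"
      using restrict_in_unit_paths[OF path_\<alpha>(1,2)] e(1) e(2)[of x] by (auto simp: K_def)
    from W(3)[OF openin_path_space_subbasic[OF K U'] this]
    have "\<forall>\<^sub>F k in sequentially. \<forall>t\<in>{0..1}. dist t x < e/2 \<longrightarrow> \<gamma> k t \<in> U"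
    proof eventually_elim
      case (elim k)
      then have sub: "?r (\<gamma> k) ` K \<subseteq> U"
        using near by blast
      show ?case
      proof (intro ballI impI)
        fix t assume t: "t \<in> {0..1::real}" "dist t x < e/2"
        then have "t \<in> K"
          by (simp add: K_def dist_commute)
        with sub t(1) show "\<gamma> k t \<in> U" by auto
      qed
    qed
    with e(1) show "\<exists>e>0. \<forall>\<^sub>F k in sequentially. \<forall>t\<in>{0..1}. dist t x < e \<longrightarrow> \<gamma> k t \<in> U"
      by (intro exI[of _ "e/2"]) simp
  qed
  moreover have "f ` D_space \<subseteq> X"
  proof clarify
    fix x y assume "(x, y) \<in> D_space"
    then have x: "x \<in> {0..1}" and "y = 0 \<or> (\<exists>k. y = arc_height k x)"
      by (auto simp: mem_D_space_iff)
    moreover have "\<alpha> x \<in> X" "\<And>k. \<gamma> k x \<in> X"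
      using path_\<alpha>(2) path_\<gamma>(2) x unfolding path_image_def by blast+
    ultimately show "f (x, y) \<in> X"
      using f_arc[OF x] by (auto simp: f_base)
  qed
  moreover have "f d0 = x0"
    using path_\<alpha>(3) by (simp add: d0_def f_base pathstart_def)
  ultimately have f: "continuous_on D_space f" "f ` D_space \<subseteq> X" "f d0 = x0" .
  have f_lambda: "(f \<circ> lambda (Suc k)) t = \<gamma> k t" if "t \<in> {0..1}" for k t
    using that by (simp add: lambda_eq_arc_height f_arc)
  have "congruent_paths X H (\<gamma> k) (\<gamma> l)" for k l
    by (rule congruent_paths_trans[OF H \<gamma> \<beta> \<gamma> _ _ congr congruent_paths_sym[OF H \<gamma> \<beta> _ congr]])
       (simp_all add: ends end_\<beta>)
  moreover have "congruent_paths X H (f \<circ> lambda (Suc k)) (f \<circ> lambda (Suc l))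
      \<longleftrightarrow> congruent_paths X H (\<gamma> k) (\<gamma> l)" for k l
    by (rule congruent_paths_cong[symmetric]) (simp_all add: path_\<gamma> ends f_lambda del: o_apply)
  ultimately have congr_lambda: "congruent_paths X H (f \<circ> lambda (Suc k)) (f \<circ> lambda (Suc l))" for k l
    by blast
  have "induced_hom X f ` S_group \<subseteq> H"
    unfolding S_group_def
  proof (rule group_hom.image_generate_subset[OF _ _ H])
    have "d0 \<in> D_space"
      by (simp add: D_space_def d0_def)
    then show "group_hom (fundamental_group D_space d0) (fundamental_group X x0) (induced_hom X f)"
      by (intro group_hom.intro group_hom_axioms.intro group_fundamental_group induced_hom_is_hom f \<open>x0 \<in> X\<close>)
    have generators: "{s_elt n | n. n \<ge> 1} = range (\<lambda>k. s_elt (Suc k))"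
    proof (intro equalityI subsetI)
      fix s assume "s \<in> {s_elt n | n. n \<ge> 1}"
      then obtain n where "s = s_elt n" "n \<ge> 1" by blast
      then have "s = s_elt (Suc (n - 1))" by simp
      then show "s \<in> range (\<lambda>k. s_elt (Suc k))" by blast
    qed auto
    have "s_elt (Suc k) \<in> carrier (fundamental_group D_space d0)" for k
      unfolding carrier_fundamental_group s_elt_def Suc_eq_plus1[symmetric]
      by (intro imageI join_reversepath_in_loops_at lambda_in_paths_from) (simp only: lambda_path)
    then show "{s_elt n | n. n \<ge> 1} \<subseteq> carrier (fundamental_group D_space d0)"
      unfolding generators by blast
    have "induced_hom X f (s_elt (Suc k)) \<in> H" for k
      unfolding s_elt_def Suc_eq_plus1[symmetric]
      by (subst induced_hom_mem_iff_congruent[OF f(1,2) lambda_in_paths_from lambda_in_paths_from])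
         (simp_all only: lambda_path congr_lambda)
    then show "induced_hom X f ` {s_elt n | n. n \<ge> 1} \<subseteq> H"
      unfolding generators by blast
  qed
  with f closed have "induced_hom X f d_inf \<in> H"
    unfolding pi1_closed_def by blast
  then have "congruent_paths X H (f \<circ> lambda (Suc 0)) (f \<circ> lambda_inf)"
    unfolding d_inf_def One_nat_def
    by (simp add: induced_hom_mem_iff_congruent[OF f(1,2) lambda_in_paths_from lambda_inf_in_paths_from]
        lambda_path lambda_inf_path)
  moreover have "congruent_paths X H (f \<circ> lambda (Suc 0)) (f \<circ> lambda_inf)
      \<longleftrightarrow> congruent_paths X H (\<gamma> 0) \<alpha>"
    by (rule congruent_paths_cong[symmetric])
       (simp_all add: path_\<gamma> path_\<alpha> ends f_lambda[unfolded o_apply] lambda_inf_def f_base)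
  ultimately have "congruent_paths X H (\<gamma> 0) \<alpha>"
    by blast
  then have "congruent_paths X H \<alpha> (\<gamma> 0)"
    by (rule congruent_paths_sym[OF H \<gamma> \<alpha> ends(1)])
  then have "congruent_paths X H \<alpha> \<beta>"
    by (rule congruent_paths_trans[OF H \<alpha> \<gamma> \<beta> _ _ _ congr, rotated 2]) (simp_all add: ends end_\<beta>)
  with not_congruent show False ..
qed

theorem theorem4p5:
  fixes X :: "'a::topological_space set" and x0 :: 'a and H :: "(real \<Rightarrow> 'a) set set"
  assumes "path_connected X"
    and "x0 \<in> X"
    and "subgroup H (fundamental_group X x0)"
  shows "(homotopically_path_Hausdorff_rel X x0 H \<longrightarrow>
            pi1_closed D_space d0 S_group d_inf X x0 H)
       \<and> (first_countable (path_space X) \<longrightarrow>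
            pi1_closed D_space d0 S_group d_inf X x0 H \<longrightarrow>
            homotopically_path_Hausdorff_rel X x0 H)
       \<and> (metrizable_space (top_of_set X) \<longrightarrow> first_countable (path_space X))"
proof (intro conjI impI)
  assume "homotopically_path_Hausdorff_rel X x0 H"
  with assms(3) show "pi1_closed D_space d0 S_group d_inf X x0 H"
    by (rule closed_if_homotopically_path_Hausdorff)
next
  assume "first_countable (path_space X)" "pi1_closed D_space d0 S_group d_inf X x0 H"
  with assms(3,2) show "homotopically_path_Hausdorff_rel X x0 H"
    by (rule homotopically_path_Hausdorff_if_closed)
next
  assume "metrizable_space (top_of_set X)"
  then show "first_countable (path_space X)"
    by (rule first_countable_path_space)
qed

end
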